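(* Let $n,m\in\mathbb{N}$, $M\in\mathbb{R}^{n\times m}$, $P\subset\{1,\dots,n\}\times\{1,\dots,m\}$ and let $\widetilde\omega>0$ be a constant independent of the rank. Then the methods $(\mathcal{M}^{(1)})^*$ and $(\mathcal{M}^{(2)})^*$ (defined in the context) are stable; that is, they are representation independent and the induced functions $f_{(\mathcal{M}^{(1)})^*},f_{(\mathcal{M}^{(2)})^*}:\mathbb{R}^{n\times m}\to\mathbb{R}^{n\times m}$ are continuous.
   Context: For a matrix $T$, $\|T\|_P^2:=\sum_{i\in P}T_i^2$; $\|\cdot\|_F$ is the Frobenius norm. A representation of rank $r$ is a pair $(X,Y)\in\mathcal{D}_r=\mathbb{R}^{n\times r}\times\mathbb{R}^{r\times m}$, $\tau_r(X,Y)=XY$; only representations with $\mathrm{rank}(XY)=r$ are used. Variational residual function: for $\omega>0$ and a current iterate $A=XY$, $$C_{M,P,X,Y}(\widetilde X,\widetilde Y):=\int_{\mathbb{V}_\omega(X,Y)}\|(\widetilde X+\Delta X)(\widetilde Y+\Delta Y)-M\|_P^2\,\mathrm{d}\Delta X\,\mathrm{d}\Delta Y,\qquad \mathbb{V}_\omega(X,Y):=\{(\Delta X,\Delta Y)\mid\|\Delta X\,Y\|_F^2+\|X\,\Delta Y\|_F^2\le\omega^2\}.$$ For each rank $r$ the methods are $$(\mathcal{M}^{(1)})^*(X,Y):=(\mathrm{argmin}_{\widetilde X}C_{M,P,X,Y}(\widetilde X,Y),\,Y),\qquad(\mathcal{M}^{(2)})^*(X,Y):=(X,\,\mathrm{argmin}_{\widetilde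 Y}C_{M,P,X,Y}(X,\widetilde Y)),$$ where, if the argmin is not unique, the element for which the product of the two output factors has smallest Frobenius norm is taken. The parameter $\omega=\omega(r)$ used for rank $r$ is scaled with $r$ so that the constants $\zeta_1=\frac{nr}{r(nr+rm+2)}$ and $\zeta_2=\frac{rm}{r(nr+rm+2)}$ satisfy $\omega(r)^2\zeta_1=\widetilde\omega^2\frac{n}{n+m}$ and $\omega(r)^2\zeta_2=\widetilde\omega^2\frac{m}{n+m}$, i.e. $\omega(r)^2=\widetilde\omega^2\frac{r(n+m)+2}{n+m}$. A method $\mathcal{M}$ (a map $\mathcal{M}_r$ on rank-$r$ representations for every $r$) is representation independent if $\tau_r(\mathcal{M}_r(G))=\tau_r(\mathcal{M}_r(\widetilde G))$ whenever $\tau_r(G)=\tau_r(\widetilde G)$. It is stable if it is representation independent and the function $f_{\mathcal{M}}(A):=\tau_{r}(\mathcal{M}_{r}(G))$, $r=\mathrm{rank}(A)$, $G$ any rank-$r$ representation of $A$ (and $f_{\mathcal{M}}(0)=0$), is continuous on $\mathbb{R}^{n\times m}$. *)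

theory Defs
  imports "HOL-Analysis.Analysis"
begin

text \<open>
  The outer dimensions $n$, $m$ are the index types \<open>'n\<close>, \<open>'m\<close>; the rank \<open>r\<close> varies inside the
  definitions and is a natural number. Accordingly an $n \times r$ matrix is the tuple of its \<open>r\<close>
  columns and an $r \times m$ matrix the tuple of its \<open>r\<close> rows, both indexed by \<open>k < r\<close> and
  \<open>undefined\<close> elsewhere, so that these sets are the spaces of the product measures below.
\<close>

abbreviation factors :: "nat \<Rightarrow> (nat \<Rightarrow> real ^ 'a) set" where
  "factors r \<equiv> {..<r} \<rightarrow>\<^sub>E UNIV"

type_synonym ('n, 'm) rep = "(nat \<Rightarrow> real ^ 'n) \<times> (nat \<Rightarrow> real ^ 'm)"

definition tau :: "nat \<Rightarrow> ('n, 'm) rep \<Rightarrow> real ^ 'm ^ 'n" where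
  "tau r = (\<lambda>(X, Y). \<chi> i j. \<Sum>k<r. X k $ i * Y k $ j)"

definition reps :: "nat \<Rightarrow> ('n::finite, 'm::finite) rep set" where
  "reps r = {(X, Y). X \<in> factors r \<and> Y \<in> factors r \<and> rank (tau r (X, Y)) = r}"

definition sqnorm_on :: "('n \<times> 'm) set \<Rightarrow> real ^ 'm ^ 'n \<Rightarrow> real" where
  "sqnorm_on P T = (\<Sum>(i, j)\<in>P. (T $ i $ j)\<^sup>2)"

definition lebesgue_reps :: "nat \<Rightarrow> ('n::finite, 'm::finite) rep measure" where
  "lebesgue_reps r = (\<Pi>\<^sub>M k\<in>{..<r}. lborel) \<Otimes>\<^sub>M (\<Pi>\<^sub>M k\<in>{..<r}. lborel)"

text \<open>On \<open>real ^ 'm ^ 'n\<close> the library's \<open>norm\<close> is the Frobenius norm.\<close>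

definition variation_set :: "real \<Rightarrow> nat \<Rightarrow> ('n::finite, 'm::finite) rep \<Rightarrow> ('n, 'm) rep set" where
  "variation_set w r = (\<lambda>(X, Y). {(dX, dY). dX \<in> factors r \<and> dY \<in> factors r \<and>
     (norm (tau r (dX, Y)))\<^sup>2 + (norm (tau r (X, dY)))\<^sup>2 \<le> w\<^sup>2})"

definition vres :: "real \<Rightarrow> real ^ 'm ^ 'n \<Rightarrow> ('n::finite \<times> 'm::finite) set \<Rightarrow> nat \<Rightarrow>
    ('n, 'm) rep \<Rightarrow> ('n, 'm) rep \<Rightarrow> real" where
  "vres w M P r G = (\<lambda>(X', Y').
     LINT D:variation_set w r G|lebesgue_reps r.
       sqnorm_on P (tau r (\<lambda>k. X' k + fst D k, \<lambda>k. Y' k + snd D k) - M))"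

definition omega :: "'n itself \<Rightarrow> 'm itself \<Rightarrow> real \<Rightarrow> nat \<Rightarrow> real" where
  "omega _ _ wt r = sqrt (wt\<^sup>2 *
     (real r * (real CARD('n) + real CARD('m)) + 2) / (real CARD('n) + real CARD('m)))"

lemma omega_scaling:
  fixes wt :: real and r :: nat
  assumes "r \<ge> 1"
  defines "n \<equiv> real CARD('n::finite)" and "m \<equiv> real CARD('m::finite)"
  defines "zeta1 \<equiv> n * real r / (real r * (n * real r + real r * m + 2))"
      and "zeta2 \<equiv> real r * m / (real r * (n * real r + real r * m + 2))"
  shows "(omega TYPE('n) TYPE('m) wt r)\<^sup>2 * zeta1 = wt\<^sup>2 * (n / (n + m))"
    and "(omega TYPE('n) TYPE('m) wt r)\<^sup>2 * zeta2 = wt\<^sup>2 * (m / (n + m))"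
proof -
  have pos: "n > 0" "m > 0" "real r > 0"
    using assms(1) by (auto simp: n_def m_def)
  have D: "n * real r + real r * m + 2 > 0"
    using pos by (simp add: add_pos_pos)
  have "(omega TYPE('n) TYPE('m) wt r)\<^sup>2 = wt\<^sup>2 * (real r * (n + m) + 2) / (n + m)"
    unfolding omega_def n_def[symmetric] m_def[symmetric]
    using pos by (intro real_sqrt_pow2) (auto intro!: divide_nonneg_pos mult_nonneg_nonneg add_nonneg_nonneg)
  hence w: "(omega TYPE('n) TYPE('m) wt r)\<^sup>2 = wt\<^sup>2 * (n * real r + real r * m + 2) / (n + m)"
    by (simp add: algebra_simps)
  have z: "zeta1 = n / (n * real r + real r * m + 2)" "zeta2 = m / (n * real r + real r * m + 2)"
    unfolding zeta1_def zeta2_def using pos by simp_all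
  show "(omega TYPE('n) TYPE('m) wt r)\<^sup>2 * zeta1 = wt\<^sup>2 * (n / (n + m))"
    and "(omega TYPE('n) TYPE('m) wt r)\<^sup>2 * zeta2 = wt\<^sup>2 * (m / (n + m))"
    unfolding w z using D by simp_all
qed

text \<open>
  The inner \<open>is_arg_min\<close> describes the set of minimisers of the variational residual; the outer
  \<open>arg_min\<close> selects from it an element whose product of factors has smallest Frobenius norm.
\<close>

definition meth1 :: "real \<Rightarrow> real ^ 'm ^ 'n \<Rightarrow> ('n::finite \<times> 'm::finite) set \<Rightarrow>
    nat \<Rightarrow> ('n, 'm) rep \<Rightarrow> ('n, 'm) rep" where
  "meth1 wt M P r = (\<lambda>(X, Y).
     (arg_min (\<lambda>X'. norm (tau r (X', Y)))
        (is_arg_min (\<lambda>X'. vres (omega TYPE('n) TYPE('m) wt r) M P r (X, Y) (X', Y))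
           (\<lambda>X'. X' \<in> factors r)),
      Y))"

definition meth2 :: "real \<Rightarrow> real ^ 'm ^ 'n \<Rightarrow> ('n::finite \<times> 'm::finite) set \<Rightarrow>
    nat \<Rightarrow> ('n, 'm) rep \<Rightarrow> ('n, 'm) rep" where
  "meth2 wt M P r = (\<lambda>(X, Y).
     (X,
      arg_min (\<lambda>Y'. norm (tau r (X, Y')))
        (is_arg_min (\<lambda>Y'. vres (omega TYPE('n) TYPE('m) wt r) M P r (X, Y) (X, Y'))
           (\<lambda>Y'. Y' \<in> factors r))))"

definition rep_independent ::
    "(nat \<Rightarrow> ('n::finite, 'm::finite) rep \<Rightarrow> ('n, 'm) rep) \<Rightarrow> bool" where
  "rep_independent \<M> \<longleftrightarrow> (\<forall>r. \<forall>G\<in>reps r. \<forall>G'\<in>reps r.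
     tau r G = tau r G' \<longrightarrow> tau r (\<M> r G) = tau r (\<M> r G'))"

definition induced_fun ::
    "(nat \<Rightarrow> ('n::finite, 'm::finite) rep \<Rightarrow> ('n, 'm) rep) \<Rightarrow> real ^ 'm ^ 'n \<Rightarrow> real ^ 'm ^ 'n" where
  "induced_fun \<M> A = (if A = 0 then 0
     else tau (rank A) (\<M> (rank A) (SOME G. G \<in> reps (rank A) \<and> tau (rank A) G = A)))"

definition stable_meth ::
    "(nat \<Rightarrow> ('n::finite, 'm::finite) rep \<Rightarrow> ('n, 'm) rep) \<Rightarrow> bool" where
  "stable_meth \<M> \<longleftrightarrow> rep_independent \<M> \<and> continuous_on UNIV (induced_fun \<M>)"

end

theory Submission
  imports Defs
begin

text \<open>
  Writing a row of a candidate \<open>X'\<close> as \<open>(z \<bullet> X\<^sub>k)\<^sub>k\<close> with \<open>z\<close> in the column space of \<open>X\<close>, the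
  corresponding row of \<open>X' Y\<close> is \<open>z A\<close> with \<open>A = X Y\<close>. The mixed terms of the variational residual
  integrate to zero by the symmetries \<open>\<Delta>X \<mapsto> -\<Delta>X\<close>, \<open>\<Delta>Y \<mapsto> -\<Delta>Y\<close>, and the remaining term quadratic in
  \<open>X'\<close> is a second moment of the ellipsoid of variations, namely \<open>\<omega>\<^sup>2 / (r (n + m) + 2)\<close> times its volume
  times \<open>\<parallel>z\<parallel>\<^sup>2\<close> for each sampled entry. With the prescribed scaling of \<open>\<omega>\<close> that factor is
  \<open>wt\<^sup>2 / (n + m)\<close> for every rank. So the new row is \<open>z A\<close> for the minimiser \<open>z\<close> of the ridge functional
  \<open>\<Sum>\<^sub>j ((z A)\<^sub>j - M\<^sub>i\<^sub>j)\<^sup>2 + \<lambda>\<^sub>i \<parallel>z\<parallel>\<^sup>2\<close>. Over all of \<open>\<real>\<^sup>n\<close> this minimiser lies in the column space of \<open>A\<close>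
  by itself, so it depends on \<open>A\<close> alone, and by strong convexity it does so continuously, also where
  the rank jumps. The second method is the first one for the transposed problem.
\<close>

section \<open>Second moments from translation invariance\<close>

text \<open>The derivative of \<open>(s - \<parallel>x\<parallel>\<^sup>2)\<^sub>+ (v \<bullet> x)\<close> in the direction \<open>p\<close> integrates to zero. In the proof
  \<open>s\<close> is approached from above by \<open>\<sigma> n\<close>, more slowly than the step \<open>\<tau> n\<close> of the difference quotient
  tends to zero, so that the kink on the sphere \<open>\<parallel>x\<parallel>\<^sup>2 = s\<close> plays no role.\<close>

lemma translation_invariant_second_moments:
  fixes \<mu> :: "'e::euclidean_space measure" and p v :: 'e
  assumes sets [measurable_cong]: "sets \<mu> = sets borel"
    and transl: "\<And>t. distr \<mu> \<mu> (\<lambda>x. x + t *\<^sub>R p) = \<mu>"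
    and fin: "\<And>R. emeasure \<mu> (cball 0 R) < \<infinity>"
    and s: "s \<ge> 0"
  shows "(\<integral>x. indicator {x. (norm x)\<^sup>2 \<le> s} x * ((s - (norm x)\<^sup>2) * (v \<bullet> p) - 2 * (p \<bullet> x) * (v \<bullet> x)) \<partial>\<mu>) = 0"
proof -
  define \<sigma> where "\<sigma> n = s + 1 / real (Suc n)" for n
  define \<tau> where "\<tau> n = 1 / (real (Suc n))\<^sup>2" for n
  define g where "g n x = max 0 (\<sigma> n - (norm x)\<^sup>2) * (v \<bullet> x)" for n x
  define h where "h n x = (g n (x + \<tau> n *\<^sub>R p) - g n x) / \<tau> n" for n x
  define f where "f x = indicator {x. (norm x)\<^sup>2 \<le> s} x * ((s - (norm x)\<^sup>2) * (v \<bullet> p) - 2 * (p \<bullet> x) * (v \<bullet> x))" for x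
  \<comment> \<open>For \<open>norm x > S\<close> both \<open>x\<close> and the shifted point have
    norm above \<open>s + 2\<close>, because \<open>\<tau> n \<le> 1\<close>, and there
    \<open>g n\<close> vanishes. Inside that ball \<open>W\<close> bounds the difference quotient
    for all \<open>n\<close>, which gives an integrable majorant.\<close>
  define S where "S = s + 2 + norm p"
  define W where "W = (2 * S * norm p + (norm p)\<^sup>2) * (norm v * (S + norm p)) + (s + 1) * (norm v * norm p)"
  have [measurable]: "g n \<in> borel_measurable \<mu>" for n
    unfolding g_def by measurable
  have tau: "\<tau> n > 0" "\<tau> n \<le> 1" for n
    by (auto simp: \<tau>_def divide_simps)
  have sig: "\<sigma> n > s" "\<sigma> n \<le> s + 1" for n
    by (auto simp: \<sigma>_def)
  have big: "max 0 (\<sigma> n - (norm x)\<^sup>2) = 0" if "norm x > s + 2" for n x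
  proof -
    have "s + 1 \<le> (s + 2)\<^sup>2" using s by (simp add: power2_eq_square algebra_simps)
    also have "\<dots> \<le> (norm x)\<^sup>2" using that s by (intro power_mono) auto
    finally show ?thesis using sig[of n] by auto
  qed
  have gint: "integrable \<mu> (g n)" for n
  proof (rule integrableI_bounded_set[where A="cball 0 (s+2)" and B="(s+1) * (norm v * (s+2))"])
    show "AE x in \<mu>. x \<notin> cball 0 (s+2) \<longrightarrow> g n x = 0"
      by (intro AE_I2) (auto simp: g_def big not_le)
    have "norm (g n x) \<le> (s+1) * (norm v * (s+2))" if "norm x \<le> s + 2" for x
      unfolding g_def norm_mult
    proof (rule mult_mono)
      show "norm (v \<bullet> x) \<le> norm v * (s + 2)"
        using that Cauchy_Schwarz_ineq2[of v x] by (smt (verit) mult_left_mono norm_ge_zero real_norm_def)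
      show "norm (max 0 (\<sigma> n - (norm x)\<^sup>2)) \<le> s + 1"
        using sig[of n] s by (auto simp: max_def) (smt (verit) zero_le_power2)
    qed (use s in auto)
    then show "AE x in \<mu>. x \<in> cball 0 (s+2) \<longrightarrow> norm (g n x) \<le> (s+1) * (norm v * (s+2))"
      by auto
  qed (use fin in \<open>auto simp: sets\<close>)
  have Tm[measurable]: "(\<lambda>x. x + t *\<^sub>R p) \<in> measurable \<mu> \<mu>" for t
    by measurable
  have gshift: "integrable \<mu> (\<lambda>x. g n (x + t *\<^sub>R p))" "(\<integral>x. g n (x + t *\<^sub>R p) \<partial>\<mu>) = (\<integral>x. g n x \<partial>\<mu>)" for n t
  proof -
    show "integrable \<mu> (\<lambda>x. g n (x + t *\<^sub>R p))"
      using gint[of n] by (subst (asm) transl[of t, symmetric]) (subst (asm) integrable_distr_eq, auto)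
    show "(\<integral>x. g n (x + t *\<^sub>R p) \<partial>\<mu>) = (\<integral>x. g n x \<partial>\<mu>)"
      by (subst (2) transl[of t, symmetric]) (subst integral_distr, auto)
  qed
  have h0: "(\<integral>x. h n x \<partial>\<mu>) = 0" for n
    unfolding h_def using gshift gint by simp
  have sq: "(norm (x + t *\<^sub>R p))\<^sup>2 = (norm x)\<^sup>2 + t * (2 * (p \<bullet> x) + t * (norm p)\<^sup>2)" for x t
    by (simp add: power2_norm_eq_inner inner_add_left inner_add_right inner_commute algebra_simps)
  have "(\<lambda>n. \<integral>x. h n x \<partial>\<mu>) \<longlonglongrightarrow> (\<integral>x. f x \<partial>\<mu>)"
  proof (rule integral_dominated_convergence[where w="\<lambda>x. indicator (cball 0 S) x * W"])
    show "f \<in> borel_measurable \<mu>" unfolding f_def by measurable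
    show "h n \<in> borel_measurable \<mu>" for n unfolding h_def by measurable
    show "integrable \<mu> (\<lambda>x. indicator (cball 0 S) x * W)"
      using fin[of S] by (auto simp: sets)
    show "AE x in \<mu>. norm (h n x) \<le> indicator (cball 0 S) x * W" for n
    proof (rule AE_I2)
      fix x
      show "norm (h n x) \<le> indicator (cball 0 S) x * W"
      proof (cases "norm x \<le> S")
        case False
        have "norm x - norm p \<le> norm (x + \<tau> n *\<^sub>R p)"
          using norm_triangle_ineq4[of "x + \<tau> n *\<^sub>R p" "\<tau> n *\<^sub>R p"] tau[of n]
            mult_right_mono[of "\<tau> n" 1 "norm p"] by simp
        then have "norm (x + \<tau> n *\<^sub>R p) > s + 2" "norm x > s + 2"
          using False by (auto simp: S_def not_le) (smt (verit) norm_ge_zero)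
        then have "h n x = 0" unfolding h_def g_def by (simp only: big) simp
        then show ?thesis using False by simp
      next
        case True
        let ?m = "\<lambda>y. max 0 (\<sigma> n - (norm y)\<^sup>2)" and ?x = "x + \<tau> n *\<^sub>R p"
        have S0: "S \<ge> 0" using s by (simp add: S_def)
        have px: "\<bar>p \<bullet> x\<bar> \<le> S * norm p"
          using Cauchy_Schwarz_ineq2[of p x] True mult_right_mono[of "norm x" S "norm p"]
          by (simp add: mult.commute)
        have nx: "norm ?x \<le> S + norm p"
          using norm_triangle_ineq[of x "\<tau> n *\<^sub>R p"] tau[of n] True
            mult_right_mono[of "\<tau> n" 1 "norm p"] by simp
        have vx: "\<bar>v \<bullet> ?x\<bar> \<le> norm v * (S + norm p)"
          using Cauchy_Schwarz_ineq2[of v ?x] mult_left_mono[OF nx, of "norm v"] by simp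
        have t2: "\<tau> n * (norm p)\<^sup>2 \<le> (norm p)\<^sup>2" "0 \<le> \<tau> n * (norm p)\<^sup>2"
          using tau[of n] mult_right_mono[of "\<tau> n" 1 "(norm p)\<^sup>2"] by auto
        have "\<bar>2 * (p \<bullet> x) + \<tau> n * (norm p)\<^sup>2\<bar> \<le> 2 * S * norm p + (norm p)\<^sup>2"
          using px t2 by (simp add: abs_le_iff)
        then have dm: "\<bar>?m ?x - ?m x\<bar> \<le> \<tau> n * (2 * S * norm p + (norm p)\<^sup>2)"
        proof -
          have "\<bar>?m ?x - ?m x\<bar> \<le> \<bar>\<tau> n * (2 * (p \<bullet> x) + \<tau> n * (norm p)\<^sup>2)\<bar>"
            using sq[of x "\<tau> n"] by (auto simp: max_def)
          also have "\<dots> = \<tau> n * \<bar>2 * (p \<bullet> x) + \<tau> n * (norm p)\<^sup>2\<bar>"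
            using tau[of n] by (simp add: abs_mult)
          also have "\<dots> \<le> \<tau> n * (2 * S * norm p + (norm p)\<^sup>2)"
            using \<open>\<bar>2 * (p \<bullet> x) + \<tau> n * (norm p)\<^sup>2\<bar> \<le> 2 * S * norm p + (norm p)\<^sup>2\<close> tau[of n]
            by (intro mult_left_mono) auto
          finally show ?thesis .
        qed
        have m1: "\<bar>?m x\<bar> \<le> s + 1"
          using sig[of n] s by (auto simp: max_def) (smt (verit) zero_le_power2)
        \<comment> \<open>A discrete product rule: the truncated factor is Lipschitz, since
          \<open>max 0\<close> is, and the linear factor changes by exactly
          \<open>\<tau> n * (v \<bullet> p)\<close>.\<close>
        have "g n ?x - g n x = (?m ?x - ?m x) * (v \<bullet> ?x) + ?m x * (\<tau> n * (v \<bullet> p))"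
          unfolding g_def by (simp add: inner_add algebra_simps)
        also have "\<bar>\<dots>\<bar> \<le> \<tau> n * (2 * S * norm p + (norm p)\<^sup>2) * (norm v * (S + norm p))
             + (s + 1) * (\<tau> n * (norm v * norm p))"
          using dm vx m1 Cauchy_Schwarz_ineq2[of v p] tau[of n] S0
          by (intro order_trans[OF abs_triangle_ineq] add_mono) (auto simp: abs_mult intro!: mult_mono)
        also have "\<dots> = \<tau> n * W" unfolding W_def by (simp add: algebra_simps)
        finally show ?thesis using True tau[of n]
          by (simp add: h_def abs_mult divide_simps mult.commute)
      qed
    qed
    show "AE x in \<mu>. (\<lambda>n. h n x) \<longlonglongrightarrow> f x"
    proof (rule AE_I2)
      fix x
      have lim\<sigma>: "\<sigma> \<longlonglongrightarrow> s" unfolding \<sigma>_def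
        using tendsto_add[OF tendsto_const LIMSEQ_inverse_real_of_nat, of s] by (simp add: inverse_eq_divide)
      have inv0: "(\<lambda>n. 1 / real (Suc n)) \<longlonglongrightarrow> 0"
        using LIMSEQ_inverse_real_of_nat by (simp add: inverse_eq_divide)
      have \<tau>sq: "\<tau> n = (1 / real (Suc n)) * (1 / real (Suc n))" for n
        by (simp add: \<tau>_def power2_eq_square)
      have lim\<tau>: "\<tau> \<longlonglongrightarrow> 0" 
        using tendsto_mult[OF inv0 inv0] by (simp add: \<tau>sq[abs_def])
      have limn: "(\<lambda>n. (norm (x + \<tau> n *\<^sub>R p))\<^sup>2) \<longlonglongrightarrow> (norm x)\<^sup>2"
        by (rule tendsto_eq_intros lim\<tau> refl)+ simp
      show "(\<lambda>n. h n x) \<longlonglongrightarrow> f x"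
      proof (cases "(norm x)\<^sup>2 \<le> s")
        case True
        \<comment> \<open>Multiplied by one more factor \<open>1 / real (Suc n)\<close> this is the
          increment of the squared norm. Once the displayed product is below 1, that increment is at
          most \<open>\<sigma> n - s\<close>, so the truncation is inactive at both points.\<close>
        have "(\<lambda>n. (1 / real (Suc n)) * (2 * (p \<bullet> x) + \<tau> n * (norm p)\<^sup>2)) \<longlonglongrightarrow> 0"
          by (rule tendsto_eq_intros inv0 lim\<tau> refl)+ simp
        then have "eventually (\<lambda>n. (1 / real (Suc n)) * (2 * (p \<bullet> x) + \<tau> n * (norm p)\<^sup>2) < 1) sequentially"
          by (rule order_tendstoD) simp
        then have "eventually (\<lambda>n. h n x = (\<sigma> n - (norm x)\<^sup>2) * (v \<bullet> p)
             - (2 * (p \<bullet> x) + \<tau> n * (norm p)\<^sup>2) * (v \<bullet> x + \<tau> n * (v \<bullet> p))) sequentially"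
        proof eventually_elim
          case (elim n)
          let ?d = "2 * (p \<bullet> x) + \<tau> n * (norm p)\<^sup>2"
          have "(1 / real (Suc n)) * ((1 / real (Suc n)) * ?d) \<le> (1 / real (Suc n)) * 1"
            using elim by (intro mult_left_mono) auto
          then have "\<tau> n * ?d \<le> 1 / real (Suc n)" by (simp add: \<tau>sq mult.assoc)
          then have 1: "max 0 (\<sigma> n - (norm (x + \<tau> n *\<^sub>R p))\<^sup>2) = \<sigma> n - (norm x)\<^sup>2 - \<tau> n * ?d"
            using True by (simp add: sq \<sigma>_def)
          have 2: "max 0 (\<sigma> n - (norm x)\<^sup>2) = \<sigma> n - (norm x)\<^sup>2"
            using True sig[of n] by simp
          have "g n (x + \<tau> n *\<^sub>R p) - g n x = \<tau> n * ((\<sigma> n - (norm x)\<^sup>2) * (v \<bullet> p) - ?d * (v \<bullet> x + \<tau> n * (v \<bullet> p)))"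
            unfolding g_def 1 2 by (simp add: inner_add algebra_simps)
          then show ?case using tau[of n] by (simp add: h_def)
        qed
        moreover have "(\<lambda>n. (\<sigma> n - (norm x)\<^sup>2) * (v \<bullet> p)
             - (2 * (p \<bullet> x) + \<tau> n * (norm p)\<^sup>2) * (v \<bullet> x + \<tau> n * (v \<bullet> p))) \<longlonglongrightarrow> f x"
          by (rule tendsto_eq_intros lim\<sigma> lim\<tau> refl)+ (use True in \<open>simp add: f_def\<close>)
        ultimately show ?thesis by (simp add: tendsto_cong)
      next
        case False
        \<comment> \<open>The midpoint eventually separates \<open>\<sigma> n\<close> from the
          squared norms of both points, so both values of \<open>g n\<close> are zero.\<close>
        define q where "q = (s + (norm x)\<^sup>2) / 2"
        have q: "s < q" "q < (norm x)\<^sup>2" using False by (auto simp: q_def)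
        have "eventually (\<lambda>n. h n x = 0) sequentially"
          using order_tendstoD(2)[OF lim\<sigma> q(1)] order_tendstoD(1)[OF limn q(2)]
          by eventually_elim (use q in \<open>simp add: h_def g_def\<close>)
        then show ?thesis using False by (simp add: f_def tendsto_eventually)
      qed
    qed
  qed
  with h0 have "(\<integral>x. f x \<partial>\<mu>) = 0" by (simp add: LIMSEQ_const_iff)
  then show ?thesis by (simp add: f_def)
qed

section \<open>Lebesgue measure on representations\<close>

text \<open>The Jacobian factor is a power of \<open>\<bar>c\<bar>\<close>, hence 1. The case
  \<open>c = 1\<close> gives translations, the case \<open>c = -1\<close> with \<open>a = 0\<close>
  the sign changes.\<close>

lemma distr_lborel_affine_isometry:
  fixes a :: "'a::euclidean_space"
  assumes "\<bar>c\<bar> = 1"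
  shows "distr lborel lborel (\<lambda>x. c *\<^sub>R x + a) = lborel"
proof -
  have "lborel = density (distr lborel borel (\<lambda>x. a + c *\<^sub>R x)) (\<lambda>_. \<bar>c\<bar>^DIM('a))"
    using assms by (intro lborel_affine) auto
  also have "\<dots> = distr lborel borel (\<lambda>x. a + c *\<^sub>R x)"
    using assms by (simp add: density_1)
  finally show ?thesis
    by (metis (no_types, lifting) add.commute distr_cong sets_lborel)
qed

text \<open>A product measure is determined by its values on boxes, and the preimage of a box under
  a componentwise map is again a box, with sides of the same measure.\<close>

lemma distr_PiM_lborel:
  fixes g :: "'i \<Rightarrow> 'a::euclidean_space \<Rightarrow> 'a"
  assumes I: "finite I" and g [measurable]: "\<And>i. i \<in> I \<Longrightarrow> g i \<in> borel_measurable borel"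
    and d: "\<And>i. i \<in> I \<Longrightarrow> distr lborel lborel (g i) = lborel"
  shows "distr (PiM I (\<lambda>_. lborel)) (PiM I (\<lambda>_. lborel)) (\<lambda>x. \<lambda>i\<in>I. g i (x i)) = PiM I (\<lambda>_. lborel)"
proof -
  interpret product_sigma_finite "\<lambda>_::'i. lborel :: 'a measure"
    by (simp add: product_sigma_finite_def sigma_finite_lborel)
  have gm: "i \<in> I \<Longrightarrow> (\<lambda>x. g i (x i)) \<in> measurable (PiM I (\<lambda>_. lborel)) lborel" for i
    using measurable_compose[OF measurable_component_singleton[of i I "\<lambda>_. lborel"], of "g i" lborel] g[of i]
    by simp
  show ?thesis
  proof (rule PiM_eqI[OF I])
    fix A :: "'i \<Rightarrow> 'a set"
    assume A: "\<And>i. i \<in> I \<Longrightarrow> A i \<in> sets lborel"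
    have *: "(\<lambda>x. \<lambda>i\<in>I. g i (x i)) -` (Pi\<^sub>E I A) \<inter> space (PiM I (\<lambda>_. lborel)) = Pi\<^sub>E I (\<lambda>i. g i -` A i)"
      by (auto simp: space_PiM PiE_iff)
    have m: "i \<in> I \<Longrightarrow> g i -` A i \<in> sets lborel" for i
      using measurable_sets[OF g[of i], of "A i"] A[of i] by simp
    have "emeasure (distr (PiM I (\<lambda>_. lborel)) (PiM I (\<lambda>_. lborel)) (\<lambda>x. \<lambda>i\<in>I. g i (x i))) (Pi\<^sub>E I A)
        = emeasure (PiM I (\<lambda>_. lborel)) (Pi\<^sub>E I (\<lambda>i. g i -` A i))"
      unfolding *[symmetric] using I A
      by (intro emeasure_distr measurable_restrict gm sets_PiM_I_finite) auto
    also have "\<dots> = (\<Prod>i\<in>I. emeasure lborel (g i -` A i))"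
      using I m by (rule emeasure_PiM)
    also have "\<dots> = (\<Prod>i\<in>I. emeasure lborel (A i))"
    proof (rule prod.cong[OF refl])
      fix i assume i: "i \<in> I"
      have "emeasure lborel (A i) = emeasure (distr lborel lborel (g i)) (A i)"
        using d[OF i] by simp
      also have "\<dots> = emeasure lborel (g i -` A i)"
        using A[OF i] g[OF i] by (subst emeasure_distr) auto
      finally show "emeasure lborel (g i -` A i) = emeasure lborel (A i)" ..
    qed
    finally show "emeasure (distr (PiM I (\<lambda>_. lborel)) (PiM I (\<lambda>_. lborel)) (\<lambda>x. \<lambda>i\<in>I. g i (x i))) (Pi\<^sub>E I A)
        = (\<Prod>i\<in>I. emeasure lborel (A i))" .
  qed simp
qed

lemma sigma_finite_PiM_lborel:
  "finite I \<Longrightarrow> sigma_finite_measure (PiM I (\<lambda>_. lborel :: 'a::euclidean_space measure))"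
  by (intro product_sigma_finite.sigma_finite)
     (simp_all add: product_sigma_finite_def sigma_finite_lborel)

lemma space_lebesgue_reps: "space (lebesgue_reps r) = factors r \<times> factors r"
  by (simp add: lebesgue_reps_def space_pair_measure space_PiM)

lemma measurable_fst_component [measurable]:
  "k < r \<Longrightarrow> (\<lambda>D. fst D k) \<in> borel_measurable (lebesgue_reps r :: ('n::finite, 'm::finite) rep measure)"
  unfolding lebesgue_reps_def
  using measurable_compose[OF measurable_fst measurable_component_singleton[of k "{..<r}" "\<lambda>_. lborel"]] by simp

lemma measurable_snd_component [measurable]:
  "k < r \<Longrightarrow> (\<lambda>D. snd D k) \<in> borel_measurable (lebesgue_reps r :: ('n::finite, 'm::finite) rep measure)"
  unfolding lebesgue_reps_def
  using measurable_compose[OF measurable_snd measurable_component_singleton[of k "{..<r}" "\<lambda>_. lborel"]] by simp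

lemma emeasure_lebesgue_reps_box:
  fixes B :: "(real ^ 'n::finite) set" and C :: "(real ^ 'm::finite) set"
  assumes "B \<in> sets borel" "C \<in> sets borel"
  shows "({..<r} \<rightarrow>\<^sub>E B) \<times> ({..<r} \<rightarrow>\<^sub>E C) \<in> sets (lebesgue_reps r)"
    and "emeasure (lebesgue_reps r) (({..<r} \<rightarrow>\<^sub>E B) \<times> ({..<r} \<rightarrow>\<^sub>E C))
      = emeasure lborel B ^ r * emeasure lborel C ^ r"
proof -
  have sets: "{..<r} \<rightarrow>\<^sub>E B \<in> sets (PiM {..<r} (\<lambda>_. lborel))" "{..<r} \<rightarrow>\<^sub>E C \<in> sets (PiM {..<r} (\<lambda>_. lborel))"
    using assms by (auto intro!: sets_PiM_I_finite)
  then show "({..<r} \<rightarrow>\<^sub>E B) \<times> ({..<r} \<rightarrow>\<^sub>E C) \<in> sets (lebesgue_reps r)"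
    unfolding lebesgue_reps_def by auto
  show "emeasure (lebesgue_reps r) (({..<r} \<rightarrow>\<^sub>E B) \<times> ({..<r} \<rightarrow>\<^sub>E C))
      = emeasure lborel B ^ r * emeasure lborel C ^ r"
    unfolding lebesgue_reps_def using sets assms
    by (simp add: sigma_finite_measure.emeasure_pair_measure_Times sigma_finite_PiM_lborel
        product_sigma_finite.emeasure_PiM product_sigma_finite_def sigma_finite_lborel)
qed

text \<open>One map covers both uses: \<open>c = d = 1\<close> translates by \<open>a\<close>, while
  \<open>a = 0\<close> with \<open>c\<close>, \<open>d\<close> equal to 1 or -1 flips signs.
  Restricting to \<open>k < r\<close> keeps the image in the space of
  \<open>lebesgue_reps r\<close>.\<close>

definition rep_affine :: "nat \<Rightarrow> real \<Rightarrow> real \<Rightarrow> ('n::finite, 'm::finite) rep \<Rightarrow> ('n, 'm) rep \<Rightarrow> ('n, 'm) rep" where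
  "rep_affine r c d a D = (\<lambda>k\<in>{..<r}. c *\<^sub>R fst D k + fst a k, \<lambda>k\<in>{..<r}. d *\<^sub>R snd D k + snd a k)"

lemma distr_rep_affine:
  fixes a :: "('n::finite, 'm::finite) rep"
  assumes "\<bar>c\<bar> = 1" "\<bar>d\<bar> = 1"
  shows "rep_affine r c d a \<in> measurable (lebesgue_reps r) (lebesgue_reps r)"
    and "distr (lebesgue_reps r) (lebesgue_reps r) (rep_affine r c d a) = lebesgue_reps r"
proof -
  define f where "f = (\<lambda>x. \<lambda>k\<in>{..<r}. c *\<^sub>R x k + fst a k)"
  define g where "g = (\<lambda>x. \<lambda>k\<in>{..<r}. d *\<^sub>R x k + snd a k)"
  let ?L = "\<lambda>_. lborel :: (real ^ 'n) measure" and ?K = "\<lambda>_. lborel :: (real ^ 'm) measure"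
  have df: "distr (PiM {..<r} ?L) (PiM {..<r} ?L) f = PiM {..<r} ?L"
    unfolding f_def using assms by (intro distr_PiM_lborel distr_lborel_affine_isometry) auto
  have dg: "distr (PiM {..<r} ?K) (PiM {..<r} ?K) g = PiM {..<r} ?K"
    unfolding g_def using assms by (intro distr_PiM_lborel distr_lborel_affine_isometry) auto
  have f [measurable]: "f \<in> measurable (PiM {..<r} ?L) (PiM {..<r} ?L)"
    unfolding f_def by measurable
  have g [measurable]: "g \<in> measurable (PiM {..<r} ?K) (PiM {..<r} ?K)"
    unfolding g_def by measurable
  have eq: "rep_affine r c d a = (\<lambda>(x, y). (f x, g y))"
    by (auto simp: rep_affine_def f_def g_def)
  show "rep_affine r c d a \<in> measurable (lebesgue_reps r) (lebesgue_reps r)"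
    unfolding eq lebesgue_reps_def by measurable
  show "distr (lebesgue_reps r) (lebesgue_reps r) (rep_affine r c d a) = lebesgue_reps r"
    unfolding eq lebesgue_reps_def
    using pair_measure_distr[OF f g] by (simp add: df dg sigma_finite_PiM_lborel)
qed

lemma distr_lebesgue_reps_swap:
  "prod.swap \<in> measurable (lebesgue_reps r) (lebesgue_reps r :: ('m::finite, 'n::finite) rep measure)"
  "distr (lebesgue_reps r :: ('n, 'm) rep measure) (lebesgue_reps r) prod.swap = lebesgue_reps r"
proof -
  interpret pair_sigma_finite "PiM {..<r} (\<lambda>_. lborel :: (real ^ 'm) measure)" "PiM {..<r} (\<lambda>_. lborel :: (real ^ 'n) measure)"
    by (simp add: pair_sigma_finite_def sigma_finite_PiM_lborel)
  have eq: "prod.swap = (\<lambda>(x, y). (y, x))" by auto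
  show "prod.swap \<in> measurable (lebesgue_reps r) (lebesgue_reps r :: ('m::finite, 'n::finite) rep measure)"
    unfolding lebesgue_reps_def eq by measurable
  show "distr (lebesgue_reps r :: ('n, 'm) rep measure) (lebesgue_reps r) prod.swap = lebesgue_reps r"
    unfolding lebesgue_reps_def eq by (rule distr_pair_swap[symmetric])
qed

section \<open>Full-rank representations\<close>

lemma tau_nth: "tau r (X, Y) $ i $ j = (\<Sum>k<r. X k $ i * Y k $ j)"
  by (simp add: tau_def)

lemma tau_cong:
  "(\<And>k. k < r \<Longrightarrow> X k = X' k) \<Longrightarrow> (\<And>k. k < r \<Longrightarrow> Y k = Y' k) \<Longrightarrow> tau r (X, Y) = tau r (X', Y')"
  by (simp add: tau_def)

lemma transpose_tau: "transpose (tau r (X, Y)) = tau r (Y, X)"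
  by (simp add: transpose_def tau_def vec_eq_iff mult.commute)

lemma reps_swap: "(X, Y) \<in> reps r \<Longrightarrow> (Y, X) \<in> reps r"
  by (simp add: reps_def transpose_tau[of r X Y, symmetric] rank_transpose)

section \<open>Rank-one matrices and their inner products\<close>

definition outer :: "real ^ 'n \<Rightarrow> real ^ 'm \<Rightarrow> real ^ 'm ^ 'n" where
  "outer z w = (\<chi> i j. z $ i * w $ j)"

lemma tau_eq_sum_outer: "tau r (X, Y) = (\<Sum>k<r. outer (X k) (Y k))"
  by (simp add: vec_eq_iff tau_nth outer_def)

lemma inner_outer_outer: "outer z w \<bullet> outer u v = (z \<bullet> u) * (w \<bullet> v)"
  unfolding inner_vec_def outer_def sum_product by (simp add: ac_simps)

lemma norm_outer: "norm (outer z w) = norm z * norm w"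
  by (simp add: norm_eq_sqrt_inner inner_outer_outer real_sqrt_mult)

lemma outer_zero: "outer z 0 = 0" "outer 0 w = 0"
  by (simp_all add: outer_def vec_eq_iff)

lemma outer_scale: "outer (c *\<^sub>R z) w = c *\<^sub>R outer z w" "outer z (c *\<^sub>R w) = c *\<^sub>R outer z w"
  by (simp_all add: outer_def vec_eq_iff)

lemma outer_sum_left: "outer (sum f A) w = (\<Sum>a\<in>A. outer (f a) w)"
  by (simp add: outer_def vec_eq_iff sum_distrib_right)

lemma outer_eq_sum_axis:
  "outer z w = (\<Sum>j\<in>UNIV. (w $ j) *\<^sub>R outer z (axis j 1))"
  "outer z w = (\<Sum>i\<in>UNIV. (z $ i) *\<^sub>R outer (axis i 1) w)"
  by (simp_all add: outer_def vec_eq_iff axis_def if_distrib if_distribR cong: if_cong)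

lemma inner_outer_tau: "outer z w \<bullet> tau r (X, Y) = (\<Sum>k<r. (z \<bullet> X k) * (w \<bullet> Y k))"
  by (simp add: tau_eq_sum_outer inner_sum_right inner_outer_outer)

lemma norm_tau_le: "norm (tau r (X, Y)) \<le> (\<Sum>k<r. norm (X k) * norm (Y k))"
  unfolding tau_eq_sum_outer by (rule order_trans[OF norm_sum]) (simp add: norm_outer)

text \<open>The columns of the product lie in the span of the \<open>r\<close> columns of
  \<open>X\<close>. Since they have rank \<open>r\<close>, the columns of \<open>X\<close> can
  neither repeat nor be dependent.\<close>

lemma reps_independent:
  assumes "(X, Y) \<in> reps r"
  shows "inj_on X {..<r}" "independent (X ` {..<r})"
proof -
  let ?A = "tau r (X, Y)" and ?B = "X ` {..<r}"
  have r: "rank ?A = r" using assms by (simp add: reps_def)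
  have "columns ?A \<subseteq> span ?B"
  proof
    fix v assume "v \<in> columns ?A"
    then obtain j where "v = column j ?A" by (auto simp: columns_def)
    also have "\<dots> = (\<Sum>k<r. (Y k $ j) *\<^sub>R X k)"
      by (simp add: column_def vec_eq_iff tau_nth mult.commute)
    also have "\<dots> \<in> span ?B" by (intro span_sum span_scale span_base) auto
    finally show "v \<in> span ?B" .
  qed
  then have "r \<le> dim ?B"
    using dim_subset[of "columns ?A" "span ?B"] by (simp add: r[unfolded column_rank_def])
  moreover have "dim ?B \<le> card ?B" by (rule dim_le_card') simp
  moreover have "card ?B \<le> r" using card_image_le[of "{..<r}" X] by simp
  ultimately have "card ?B = r" "dim ?B = r" by auto
  then show "inj_on X {..<r}" by (simp add: eq_card_imp_inj_on)
  show "independent ?B"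
    using \<open>card ?B = r\<close> \<open>dim ?B = r\<close> card_eq_dim[of ?B ?B] span_superset[of ?B] by simp
qed

text \<open>The vector dual to \<open>X k\<close> is the component of \<open>X k\<close> orthogonal
  to the span of the other vectors, divided by its squared length. Independence makes this component
  nonzero.\<close>

lemma dual_vectors_exist:
  fixes X :: "nat \<Rightarrow> 'a::euclidean_space"
  assumes inj: "inj_on X {..<r}" and ind: "independent (X ` {..<r})"
  obtains e where "\<And>k. k < r \<Longrightarrow> e k \<in> span (X ` {..<r})"
    and "\<And>k l. k < r \<Longrightarrow> l < r \<Longrightarrow> e k \<bullet> X l = (if k = l then 1 else 0)"
proof -
  have "\<exists>q. q \<in> span (X ` {..<r}) \<and> (\<forall>l<r. q \<bullet> X l = (if k = l then 1 else 0))" if k: "k < r" for k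
  proof -
    let ?O = "X ` ({..<r} - {k})"
    obtain y z where y: "y \<in> span ?O" and z: "\<And>w. w \<in> span ?O \<Longrightarrow> orthogonal z w" and eq: "X k = y + z"
      using orthogonal_subspace_decomp_exists[of ?O "X k"] by metis
    have O: "?O = X ` {..<r} - {X k}"
      using inj k by (auto simp: inj_on_def)
    have "X k \<notin> span ?O"
      using ind k unfolding O dependent_def by auto
    then have "z \<noteq> 0" using y eq by auto
    have "span ?O \<subseteq> span (X ` {..<r})" by (intro span_mono) auto
    then have "X k - y \<in> span (X ` {..<r})"
      using y k by (intro span_diff) (auto simp: span_base)
    then have "z \<in> span (X ` {..<r})" by (simp add: eq)
    have zk: "z \<bullet> X k = z \<bullet> z"
      using z[OF y] by (simp add: eq inner_add_right orthogonal_def)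
    have "(1 / (z \<bullet> z)) *\<^sub>R z \<in> span (X ` {..<r})"
      using \<open>z \<in> _\<close> by (rule span_scale)
    moreover have "((1 / (z \<bullet> z)) *\<^sub>R z) \<bullet> X l = (if k = l then 1 else 0)" if "l < r" for l
    proof (cases "k = l")
      case False
      then have "z \<bullet> X l = 0"
        using that z[OF span_base[of "X l" ?O]] by (auto simp: orthogonal_def)
      then show ?thesis using False by simp
    qed (use zk \<open>z \<noteq> 0\<close> in simp)
    ultimately show ?thesis by blast
  qed
  then show ?thesis using that by metis
qed

lemma reps_dual_vectors:
  assumes "(X, Y) \<in> reps r"
  obtains e where "\<And>k. k < r \<Longrightarrow> e k \<in> span (X ` {..<r})"
    and "\<And>k l. k < r \<Longrightarrow> l < r \<Longrightarrow> e k \<bullet> X l = (if k = l then 1 else 0)"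
  using dual_vectors_exist reps_independent[OF assms] by metis

text \<open>Coefficients indexed by \<open>k < r\<close>, and not by the vectors of the image, can
  be used directly as rows of a second factor or as a variation of it.\<close>

lemma span_image_lessThan:
  fixes X :: "nat \<Rightarrow> 'a::real_vector"
  assumes "z \<in> span (X ` {..<r})"
  obtains \<alpha> where "z = (\<Sum>k<r. \<alpha> k *\<^sub>R X k)"
proof -
  have "\<exists>\<alpha>. z = (\<Sum>k<r. \<alpha> k *\<^sub>R X k)"
    using assms
  proof (induction rule: span_induct_alt)
    case base
    then show ?case by (intro exI[of _ "\<lambda>_. 0"]) simp
  next
    case (step c x y)
    then obtain k \<alpha> where k: "k < r" "x = X k" and y: "y = (\<Sum>k<r. \<alpha> k *\<^sub>R X k)" by auto
    have "(\<Sum>l<r. (if l = k then c else 0) *\<^sub>R X l) = (\<Sum>l<r. if l = k then c *\<^sub>R X l else 0)"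
      by (intro sum.cong) auto
    then have "(\<Sum>l<r. (\<alpha> l + (if l = k then c else 0)) *\<^sub>R X l) = c *\<^sub>R x + y"
      using k unfolding scaleR_add_left sum.distrib by (simp add: y)
    then show ?case by metis
  qed
  then show ?thesis using that by blast
qed

text \<open>Rank factorization: \<open>X\<close> lists a basis of the column space and
  \<open>Y\<close> holds the coordinates of the columns. It ensures that the choice in
  \<open>induced_fun\<close> picks a genuine representation.\<close>

lemma reps_exist:
  fixes A :: "real ^ 'm::finite ^ 'n::finite"
  shows "\<exists>G. G \<in> reps (rank A) \<and> tau (rank A) G = A"
proof -
  define r where "r = rank A"
  obtain B where B: "B \<subseteq> columns A" "independent B" "columns A \<subseteq> span B" "card B = r"
    using basis_exists[of "columns A"] by (auto simp: r_def column_rank_def)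
  have "finite B" using B(2) by (rule finiteI_independent)
  then obtain h where h: "bij_betw h {..<r} B"
    using B(4) by (metis atLeast0LessThan ex_bij_betw_nat_finite)
  define X where "X = restrict h {..<r}"
  have XB: "X ` {..<r} = B" using h by (simp add: X_def bij_betw_def)
  have "\<exists>\<alpha>. column j A = (\<Sum>k<r. \<alpha> k *\<^sub>R X k)" for j
  proof -
    have "column j A \<in> span (X ` {..<r})" using B(3) XB by (auto simp: columns_def)
    then show ?thesis by (rule span_image_lessThan) blast
  qed
  then obtain \<alpha> where \<alpha>: "\<And>j. column j A = (\<Sum>k<r. \<alpha> j k *\<^sub>R X k)" by metis
  define Y where "Y = (\<lambda>k\<in>{..<r}. \<chi> j. \<alpha> j k)"
  have "A $ i $ j = tau r (X, Y) $ i $ j" for i j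
    using arg_cong[OF \<alpha>[of j], of "\<lambda>v. v $ i"]
    by (simp add: column_def tau_nth Y_def mult.commute)
  then have "tau r (X, Y) = A" by (simp add: vec_eq_iff)
  moreover have "(X, Y) \<in> reps r"
    using calculation by (simp add: reps_def X_def Y_def r_def)
  ultimately show ?thesis unfolding r_def by blast
qed

section \<open>The variation set\<close>

text \<open>This linear map sends a variation to the pair of matrices whose joint norm is
  constrained in \<open>variation_set\<close>. The variation set is thus the preimage of a ball, and
  its moments can be computed from the image of Lebesgue measure on a Euclidean space.\<close>

definition variation_map :: "nat \<Rightarrow> ('n::finite, 'm::finite) rep \<Rightarrow> ('n, 'm) rep
    \<Rightarrow> (real ^ 'm ^ 'n) \<times> (real ^ 'm ^ 'n)" where
  "variation_map r G D = (tau r (fst D, snd G), tau r (fst G, snd D))"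

lemma variation_set_eq:
  fixes G :: "('n::finite, 'm::finite) rep"
  shows "variation_set w r G = {D \<in> space (lebesgue_reps r). (norm (variation_map r G D))\<^sup>2 \<le> w\<^sup>2}"
proof -
  have "(norm (a, b))\<^sup>2 = (norm a)\<^sup>2 + (norm b)\<^sup>2" for a b :: "real ^ 'm ^ 'n"
    by (simp add: norm_Pair)
  then show ?thesis
    by (cases G) (auto simp: variation_set_def variation_map_def space_lebesgue_reps)
qed

section \<open>Measurability and linearity of the variation map\<close>

lemma borel_measurable_vec:
  fixes f :: "'a \<Rightarrow> 'b::euclidean_space ^ 'n::finite"
  assumes "\<And>i. (\<lambda>x. f x $ i) \<in> borel_measurable M"
  shows "f \<in> borel_measurable M"
  by (rule borel_measurable_euclidean_space[THEN iffD2])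
     (use assms in \<open>auto simp: Basis_vec_def inner_axis\<close>)

lemma borel_measurable_vec_nth [measurable (raw)]:
  fixes f :: "'a \<Rightarrow> 'b::euclidean_space ^ 'n::finite"
  assumes [measurable]: "f \<in> borel_measurable M"
  shows "(\<lambda>x. f x $ i) \<in> borel_measurable M"
  by (rule borel_measurable_continuous_on[OF _ assms]) (intro continuous_intros)

lemma borel_measurable_tau:
  assumes [measurable]: "\<And>k. k < r \<Longrightarrow> (\<lambda>D. f D k) \<in> borel_measurable M"
    "\<And>k. k < r \<Longrightarrow> (\<lambda>D. g D k) \<in> borel_measurable M"
  shows "(\<lambda>D. tau r (f D, g D)) \<in> borel_measurable M"
  by (intro borel_measurable_vec) (simp add: tau_nth)

lemma borel_measurable_variation_map [measurable]:
  "variation_map r G \<in> borel_measurable (lebesgue_reps r)"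
  unfolding variation_map_def by (intro borel_measurable_Pair borel_measurable_tau) auto

lemma tau_add_scaleR:
  "tau r (\<lambda>k. U k + t *\<^sub>R V k, Y) = tau r (U, Y) + t *\<^sub>R tau r (V, Y)"
  "tau r (X, \<lambda>k. U' k + t *\<^sub>R V' k) = tau r (X, U') + t *\<^sub>R tau r (X, V')"
  by (simp_all add: vec_eq_iff tau_nth sum.distrib sum_distrib_left distrib_left distrib_right mult_ac)

text \<open>By linearity, translating a variation translates its image. Invariance of Lebesgue
  measure therefore passes to the image measure, in the directions that are values of
  \<open>variation_map\<close>.\<close>

lemma variation_map_rep_affine:
  "variation_map r G (rep_affine r 1 1 (\<lambda>k. t *\<^sub>R fst a k, \<lambda>k. t *\<^sub>R snd a k) D)
    = variation_map r G D + t *\<^sub>R variation_map r G a"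
proof -
  have "tau r (\<lambda>k\<in>{..<r}. 1 *\<^sub>R fst D k + t *\<^sub>R fst a k, snd G) = tau r (\<lambda>k. fst D k + t *\<^sub>R fst a k, snd G)"
    "tau r (fst G, \<lambda>k\<in>{..<r}. 1 *\<^sub>R snd D k + t *\<^sub>R snd a k) = tau r (fst G, \<lambda>k. snd D k + t *\<^sub>R snd a k)"
    by (intro tau_cong; simp)+
  then show ?thesis
    by (simp add: variation_map_def rep_affine_def tau_add_scaleR)
qed

text \<open>Dual vectors of the columns of \<open>X\<close> undo multiplication by \<open>X\<close>,
  so each entry of a variation of \<open>Y\<close> is a linear functional of its image.\<close>

lemma snd_component_eq_inner:
  assumes "\<And>l. l < r \<Longrightarrow> e \<bullet> X l = (if k = l then 1 else 0)" "k < r"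
  shows "outer e (axis j 1) \<bullet> tau r (X, U) = U k $ j"
proof -
  have "(\<Sum>l<r. (e \<bullet> X l) * U l $ j) = (\<Sum>l<r. if k = l then U l $ j else 0)"
    using assms by (intro sum.cong) auto
  then show ?thesis using assms by (simp add: inner_outer_tau inner_axis')
qed

lemma fst_component_eq_inner:
  assumes "\<And>l. l < r \<Longrightarrow> e \<bullet> Y l = (if k = l then 1 else 0)" "k < r"
  shows "outer (axis i 1) e \<bullet> tau r (U, Y) = U k $ i"
proof -
  have "(\<Sum>l<r. U l $ i * (e \<bullet> Y l)) = (\<Sum>l<r. if k = l then U l $ i else 0)"
    using assms by (intro sum.cong) auto
  then show ?thesis using assms by (simp add: inner_outer_tau inner_axis')
qed

lemma norm_le_card_bound:
  fixes v :: "real ^ 'n"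
  assumes "\<And>i. \<bar>v $ i\<bar> \<le> B"
  shows "norm v \<le> real CARD('n) * B"
  using norm_le_l1_cart[of v] sum_bounded_above[of UNIV "\<lambda>i. \<bar>v $ i\<bar>" B] assms by simp

text \<open>A quantitative form of injectivity: every entry of a variation is the inner product of
  its image with a rank-one matrix built from a dual vector, and Cauchy-Schwarz bounds it. Summing
  over \<open>k\<close> makes the constant uniform.\<close>

lemma variation_bounded:
  fixes G :: "('n::finite, 'm::finite) rep"
  assumes G: "G \<in> reps r"
  obtains C where "C \<ge> 0"
    and "\<And>D k. k < r \<Longrightarrow> norm (fst D k) \<le> C * norm (variation_map r G D)"
    and "\<And>D k. k < r \<Longrightarrow> norm (snd D k) \<le> C * norm (variation_map r G D)"
proof -
  obtain X Y where XY: "G = (X, Y)" by (cases G)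
  obtain e where e: "\<And>k l. k < r \<Longrightarrow> l < r \<Longrightarrow> e k \<bullet> X l = (if k = l then 1 else 0)"
    using reps_dual_vectors[of X Y r] G XY by metis
  obtain f where f: "\<And>k l. k < r \<Longrightarrow> l < r \<Longrightarrow> f k \<bullet> Y l = (if k = l then 1 else 0)"
    using reps_dual_vectors[OF reps_swap[of X Y r]] G XY by metis
  define C where "C = (\<Sum>k<r. real CARD('n) * norm (f k)) + (\<Sum>k<r. real CARD('m) * norm (e k))"
  have C: "real CARD('n) * norm (f k) \<le> C" "real CARD('m) * norm (e k) \<le> C" if "k < r" for k
    unfolding C_def
    by (rule order_trans[OF member_le_sum[of k "{..<r}"]]; use that in \<open>auto intro!: sum_nonneg\<close>)+
  have "norm (fst D k) \<le> C * norm (variation_map r G D)" if k: "k < r" for D k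
  proof -
    have "\<bar>fst D k $ i\<bar> \<le> norm (f k) * norm (variation_map r G D)" for i
    proof -
      have "\<bar>fst D k $ i\<bar> \<le> norm (f k) * norm (tau r (fst D, Y))"
        using Cauchy_Schwarz_ineq2[of "outer (axis i 1) (f k)" "tau r (fst D, Y)"]
        by (simp add: fst_component_eq_inner f k norm_outer)
      also have "\<dots> \<le> norm (f k) * norm (variation_map r G D)"
        by (intro mult_left_mono) (use norm_fst_le[of "tau r (fst D, Y)"] in \<open>auto simp: variation_map_def XY\<close>)
      finally show ?thesis .
    qed
    from norm_le_card_bound[OF this] show ?thesis
      using mult_right_mono[OF C(1)[OF k], of "norm (variation_map r G D)"] by (simp add: mult.assoc)
  qed
  moreover have "norm (snd D k) \<le> C * norm (variation_map r G D)" if k: "k < r" for D k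
  proof -
    have "\<bar>snd D k $ i\<bar> \<le> norm (e k) * norm (variation_map r G D)" for i
    proof -
      have "\<bar>snd D k $ i\<bar> \<le> norm (e k) * norm (tau r (X, snd D))"
        using Cauchy_Schwarz_ineq2[of "outer (e k) (axis i 1)" "tau r (X, snd D)"]
        by (simp add: snd_component_eq_inner e k norm_outer)
      also have "\<dots> \<le> norm (e k) * norm (variation_map r G D)"
        by (intro mult_left_mono) (use norm_snd_le[of "tau r (X, snd D)"] in \<open>auto simp: variation_map_def XY\<close>)
      finally show ?thesis .
    qed
    from norm_le_card_bound[OF this] show ?thesis
      using mult_right_mono[OF C(2)[OF k], of "norm (variation_map r G D)"] by (simp add: mult.assoc)
  qed
  moreover have "C \<ge> 0" unfolding C_def by (intro add_nonneg_nonneg sum_nonneg) auto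
  ultimately show ?thesis using that by blast
qed

text \<open>The bound on the components puts the preimage of a ball into a box of finite Lebesgue
  measure. This is the finiteness that the second-moment identity asks of the image measure.\<close>

lemma emeasure_variation_ball_finite:
  fixes G :: "('n::finite, 'm::finite) rep"
  assumes "G \<in> reps r"
  shows "emeasure (lebesgue_reps r) {D \<in> space (lebesgue_reps r). norm (variation_map r G D) \<le> R} < \<infinity>"
proof -
  obtain C where C: "C \<ge> 0" "\<And>D k. k < r \<Longrightarrow> norm (fst D k) \<le> C * norm (variation_map r G D)"
    "\<And>D k. k < r \<Longrightarrow> norm (snd D k) \<le> C * norm (variation_map r G D)"
    using variation_bounded[OF assms] by metis
  let ?B = "({..<r} \<rightarrow>\<^sub>E cball (0::real^'n) (C * R)) \<times> ({..<r} \<rightarrow>\<^sub>E cball (0::real^'m) (C * R))"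
  have "emeasure (lebesgue_reps r) {D \<in> space (lebesgue_reps r). norm (variation_map r G D) \<le> R}
      \<le> emeasure (lebesgue_reps r) ?B"
  proof (rule emeasure_mono)
    show "{D \<in> space (lebesgue_reps r). norm (variation_map r G D) \<le> R} \<subseteq> ?B"
    proof
      fix D assume "D \<in> {D \<in> space (lebesgue_reps r). norm (variation_map r G D) \<le> R}"
      then have D: "D \<in> factors r \<times> factors r" "C * norm (variation_map r G D) \<le> C * R"
        using C(1) by (auto simp: space_lebesgue_reps intro: mult_left_mono)
      have "norm (fst D k) \<le> C * R" "norm (snd D k) \<le> C * R" if "k < r" for k
        using C(2,3)[OF that, of D] D(2) by linarith+
      with D(1) show "D \<in> ?B" by (auto simp: PiE_iff)
    qed
  qed (rule emeasure_lebesgue_reps_box; simp)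
  also have "\<dots> < \<infinity>"
    using emeasure_lborel_cball_finite[of "0::real^'n" "C * R"] emeasure_lborel_cball_finite[of "0::real^'m" "C * R"]
    by (subst emeasure_lebesgue_reps_box) (auto simp: ennreal_mult_less_top power_less_top_ennreal)
  finally show ?thesis .
qed

lemma variation_set_measure:
  fixes G :: "('n::finite, 'm::finite) rep"
  assumes "G \<in> reps r"
  shows "variation_set w r G \<in> sets (lebesgue_reps r)"
    and "emeasure (lebesgue_reps r) (variation_set w r G) < \<infinity>"
    and "w \<noteq> 0 \<Longrightarrow> measure (lebesgue_reps r) (variation_set w r G) > 0"
proof -
  show meas: "variation_set w r G \<in> sets (lebesgue_reps r)"
    unfolding variation_set_eq by measurable
  show fin: "emeasure (lebesgue_reps r) (variation_set w r G) < \<infinity>"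
    using emeasure_variation_ball_finite[OF assms, of "\<bar>w\<bar>"]
    by (simp add: variation_set_eq abs_le_square_iff[symmetric])
  assume w: "w \<noteq> 0"
  obtain X Y where XY: "G = (X, Y)" by (cases G)
  \<comment> \<open>The operator bound of \<open>variation_map\<close> on boxes; the summand 1 keeps
    it positive even for \<open>r = 0\<close>. With radius \<open>\<bar>w\<bar> / K\<close> a box of
    balls fits into the variation set and has positive measure.\<close>
  define K where "K = (\<Sum>k<r. norm (Y k)) + (\<Sum>k<r. norm (X k)) + 1"
  have K: "K > 0" unfolding K_def by (intro add_nonneg_pos add_nonneg_nonneg sum_nonneg) auto
  define \<delta> where "\<delta> = \<bar>w\<bar> / K"
  have \<delta>: "\<delta> > 0" using w K by (simp add: \<delta>_def)
  let ?B = "({..<r} \<rightarrow>\<^sub>E ball (0::real^'n) \<delta>) \<times> ({..<r} \<rightarrow>\<^sub>E ball (0::real^'m) \<delta>)"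
  have "?B \<subseteq> variation_set w r G"
  proof
    fix D :: "('n, 'm) rep" assume D: "D \<in> ?B"
    have n: "norm (fst D k) \<le> \<delta>" "norm (snd D k) \<le> \<delta>" if "k < r" for k
      using PiE_mem[of "fst D" "{..<r}" "\<lambda>_. ball 0 \<delta>" k] PiE_mem[of "snd D" "{..<r}" "\<lambda>_. ball 0 \<delta>" k]
        D that by (simp_all add: mem_Times_iff)
    have "norm (variation_map r G D) \<le> norm (tau r (fst D, Y)) + norm (tau r (X, snd D))"
      by (simp add: variation_map_def XY norm_Pair_le)
    also have "\<dots> \<le> (\<Sum>k<r. \<delta> * norm (Y k)) + (\<Sum>k<r. norm (X k) * \<delta>)"
      by (intro add_mono order_trans[OF norm_tau_le] sum_mono mult_mono) (use n \<delta> in auto)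
    also have "\<dots> \<le> \<delta> * K"
      using \<delta> by (simp add: K_def sum_distrib_left algebra_simps)
    also have "\<dots> = \<bar>w\<bar>" using K by (simp add: \<delta>_def)
    finally show "D \<in> variation_set w r G"
      using D by (auto simp: variation_set_eq space_lebesgue_reps PiE_iff abs_le_square_iff[symmetric])
  qed
  then have "emeasure (lebesgue_reps r) ?B \<le> emeasure (lebesgue_reps r) (variation_set w r G)"
    using meas by (intro emeasure_mono)
  moreover have "emeasure lborel (ball (0::real^'n) \<delta>) \<noteq> 0" "emeasure lborel (ball (0::real^'m) \<delta>) \<noteq> 0"
    using \<delta> open_not_negligible[of "ball (0::real^'n) \<delta>"] open_not_negligible[of "ball (0::real^'m) \<delta>"]
    by (auto simp: negligible_iff_null_sets null_sets_def)
  then have "emeasure (lebesgue_reps r) ?B \<noteq> 0"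
    by (simp add: emeasure_lebesgue_reps_box)
  ultimately have "emeasure (lebesgue_reps r) (variation_set w r G) \<noteq> 0"
    by (metis le_zero_eq)
  then have "0 < emeasure (lebesgue_reps r) (variation_set w r G)"
    by (simp only: zero_less_iff_neq_zero not_False_eq_True)
  then show "measure (lebesgue_reps r) (variation_set w r G) > 0"
    using fin unfolding measure_def enn2real_positive_iff infinity_ennreal_def by blast
qed

section \<open>Integration over the variation set\<close>

abbreviation variation_measure :: "real \<Rightarrow> nat \<Rightarrow> ('n::finite, 'm::finite) rep \<Rightarrow> ('n, 'm) rep measure" where
  "variation_measure w r G \<equiv> restrict_space (lebesgue_reps r) (variation_set w r G)"

lemma variation_integral:
  assumes "G \<in> reps r"
  shows "(LINT D:variation_set w r G|lebesgue_reps r. f D :: real) = (LINT D|variation_measure w r G. f D)"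
  using variation_set_measure(1)[OF assms, of w]
  by (simp add: set_lebesgue_integral_def integral_restrict_space sets.Int_space_eq2)

lemma space_variation_measure:
  "G \<in> reps r \<Longrightarrow> space (variation_measure w r G) = variation_set w r G"
  using sets.sets_into_space[OF variation_set_measure(1), of G r w] by (auto simp: space_restrict_space)

lemma finite_measure_variation: "G \<in> reps r \<Longrightarrow> finite_measure (variation_measure w r G)"
  using variation_set_measure[of G r w]
  by (intro finite_measureI) (auto simp: space_variation_measure emeasure_restrict_space sets.Int_space_eq2)

lemma measure_variation:
  "G \<in> reps r \<Longrightarrow> measure (variation_measure w r G) (space (variation_measure w r G))
    = measure (lebesgue_reps r) (variation_set w r G)"
  using variation_set_measure(1)[of G r w]
  by (simp add: space_variation_measure measure_restrict_space sets.Int_space_eq2)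

lemma variation_integrable:
  assumes G: "G \<in> reps r" and f: "f \<in> borel_measurable (lebesgue_reps r)"
    and B: "\<And>D. D \<in> variation_set w r G \<Longrightarrow> norm (f D :: real) \<le> B"
  shows "integrable (variation_measure w r G) f"
proof -
  interpret finite_measure "variation_measure w r G" using G by (rule finite_measure_variation)
  show ?thesis
    using B by (intro integrable_const_bound[of _ B] AE_I2 measurable_restrict_space1 f)
      (simp_all add: space_variation_measure[OF G])
qed

text \<open>On the variation set \<open>variation_map\<close> takes values in a compact ball, where
  \<open>F\<close> is bounded, and the set has finite measure.\<close>

lemma variation_integrable_continuous:
  fixes F :: "_ \<Rightarrow> real"
  assumes G: "G \<in> reps r" and F: "continuous_on UNIV F"
  shows "integrable (variation_measure w r G) (\<lambda>D. F (variation_map r G D))"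
proof -
  have "compact (F ` cball 0 \<bar>w\<bar>)"
    using F by (intro compact_continuous_image) (auto intro: continuous_on_subset)
  then have "bounded (F ` cball 0 \<bar>w\<bar>)" by (rule compact_imp_bounded)
  then obtain B where "\<forall>y\<in>F ` cball 0 \<bar>w\<bar>. norm y \<le> B"
    unfolding bounded_iff by blast
  then have B: "norm (F x) \<le> B" if "norm x \<le> \<bar>w\<bar>" for x
    using that by simp
  show ?thesis
  proof (rule variation_integrable[OF G])
    show "(\<lambda>D. F (variation_map r G D)) \<in> borel_measurable (lebesgue_reps r)"
      by (rule borel_measurable_continuous_on[OF F]) measurable
    show "norm (F (variation_map r G D)) \<le> B" if "D \<in> variation_set w r G" for D
      using that B by (simp add: variation_set_eq abs_le_square_iff[symmetric])
  qed
qed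

text \<open>The image of Lebesgue measure under \<open>variation_map\<close> is invariant under
  translation by multiples of \<open>variation_map r G a\<close>, so the general identity applies
  with this direction as \<open>p\<close>. All second moments in such directions reduce to one
  scalar integral, the mean deficit.\<close>

lemma variation_second_moment:
  fixes G a :: "('n::finite, 'm::finite) rep"
  assumes G: "G \<in> reps r"
  shows "(LINT D|variation_measure w r G. (variation_map r G a \<bullet> variation_map r G D) * (v \<bullet> variation_map r G D))
    = (v \<bullet> variation_map r G a) / 2 * (LINT D|variation_measure w r G. w\<^sup>2 - (norm (variation_map r G D))\<^sup>2)"
proof -
  let ?L = "lebesgue_reps r :: ('n, 'm) rep measure" and ?\<Phi> = "variation_map r G"
    and ?V = "variation_set w r G" and ?N = "variation_measure w r G"
  let ?F = "\<lambda>x. (w\<^sup>2 - (norm x)\<^sup>2) * (v \<bullet> ?\<Phi> a) - 2 * (?\<Phi> a \<bullet> x) * (v \<bullet> x)"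
  define \<mu> where "\<mu> = distr ?L borel ?\<Phi>"
  have "(\<integral>x. indicator {x. (norm x)\<^sup>2 \<le> w\<^sup>2} x * ?F x \<partial>\<mu>) = 0"
  proof (rule translation_invariant_second_moments)
    show "sets \<mu> = sets borel" by (simp add: \<mu>_def)
    show "emeasure \<mu> (cball 0 R) < \<infinity>" for R
    proof -
      have "?\<Phi> -` cball 0 R \<inter> space ?L = {D \<in> space ?L. norm (?\<Phi> D) \<le> R}" by auto
      then show ?thesis
        using emeasure_variation_ball_finite[OF G, of R] by (simp add: \<mu>_def emeasure_distr)
    qed
    show "distr \<mu> \<mu> (\<lambda>x. x + t *\<^sub>R ?\<Phi> a) = \<mu>" for t
    proof -
      let ?T = "rep_affine r 1 1 (\<lambda>k. t *\<^sub>R fst a k, \<lambda>k. t *\<^sub>R snd a k)"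
      have T [measurable]: "?T \<in> measurable ?L ?L" by (rule distr_rep_affine) auto
      have "distr \<mu> \<mu> (\<lambda>x. x + t *\<^sub>R ?\<Phi> a) = distr \<mu> borel (\<lambda>x. x + t *\<^sub>R ?\<Phi> a)"
        by (rule distr_cong) (auto simp: \<mu>_def)
      also have "\<dots> = distr ?L borel (?\<Phi> \<circ> ?T)"
        unfolding \<mu>_def by (subst distr_distr) (auto simp: comp_def variation_map_rep_affine)
      also have "\<dots> = distr (distr ?L ?L ?T) borel ?\<Phi>"
        by (subst distr_distr) auto
      also have "distr ?L ?L ?T = ?L" by (rule distr_rep_affine) auto
      finally show ?thesis by (simp add: \<mu>_def)
    qed
  qed simp
  also have "(\<integral>x. indicator {x. (norm x)\<^sup>2 \<le> w\<^sup>2} x * ?F x \<partial>\<mu>) = (\<integral>D. indicator {x. (norm x)\<^sup>2 \<le> w\<^sup>2} (?\<Phi> D) * ?F (?\<Phi> D) \<partial>?L)"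
    unfolding \<mu>_def by (subst integral_distr) auto
  also have "\<dots> = (LINT D:?V|?L. ?F (?\<Phi> D))"
    unfolding set_lebesgue_integral_def
    by (intro Bochner_Integration.integral_cong) (auto simp: variation_set_eq indicator_def)
  also have "\<dots> = (LINT D|?N. ?F (?\<Phi> D))" using G by (rule variation_integral)
  also have "\<dots> = (LINT D|?N. (w\<^sup>2 - (norm (?\<Phi> D))\<^sup>2) * (v \<bullet> ?\<Phi> a)) - (LINT D|?N. 2 * ((?\<Phi> a \<bullet> ?\<Phi> D) * (v \<bullet> ?\<Phi> D)))"
    unfolding mult.assoc
    by (intro Bochner_Integration.integral_diff variation_integrable_continuous[OF G, of "\<lambda>x. _ x * _"]
        variation_integrable_continuous[OF G, of "\<lambda>x. 2 * (_ x)"] continuous_intros)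
  also have "\<dots> = (v \<bullet> ?\<Phi> a) * (LINT D|?N. w\<^sup>2 - (norm (?\<Phi> D))\<^sup>2) - 2 * (LINT D|?N. (?\<Phi> a \<bullet> ?\<Phi> D) * (v \<bullet> ?\<Phi> D))"
    by simp
  finally show ?thesis by simp
qed

text \<open>A trace formula: one factor of each product pairs with the image of a unit variation,
  the other with its dual functional. The squared norm becomes a sum of products whose integrals
  \<open>variation_second_moment\<close> evaluates.\<close>

lemma variation_norm_decomposition:
  assumes e: "\<And>k l. k < r \<Longrightarrow> l < r \<Longrightarrow> e k \<bullet> X l = (if k = l then 1 else 0)"
    and f: "\<And>k l. k < r \<Longrightarrow> l < r \<Longrightarrow> f k \<bullet> Y l = (if k = l then 1 else 0)"
  shows "(norm (variation_map r (X, Y) D))\<^sup>2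
    = (\<Sum>k<r. \<Sum>i\<in>UNIV. ((outer (axis i 1) (Y k), 0) \<bullet> variation_map r (X, Y) D)
          * ((outer (axis i 1) (f k), 0) \<bullet> variation_map r (X, Y) D))
    + (\<Sum>k<r. \<Sum>j\<in>UNIV. ((0, outer (X k) (axis j 1)) \<bullet> variation_map r (X, Y) D)
          * ((0, outer (e k) (axis j 1)) \<bullet> variation_map r (X, Y) D))"
proof -
  obtain U W where D: "D = (U, W)" by (cases D)
  have 1: "tau r (U, Y) = (\<Sum>k<r. \<Sum>i\<in>UNIV. (U k $ i) *\<^sub>R outer (axis i 1) (Y k))"
    unfolding tau_eq_sum_outer by (intro sum.cong refl outer_eq_sum_axis)
  have 2: "tau r (X, W) = (\<Sum>k<r. \<Sum>j\<in>UNIV. (W k $ j) *\<^sub>R outer (X k) (axis j 1))"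
    unfolding tau_eq_sum_outer by (intro sum.cong refl outer_eq_sum_axis)
  have "(norm (variation_map r (X, Y) D))\<^sup>2 = tau r (U, Y) \<bullet> tau r (U, Y) + tau r (X, W) \<bullet> tau r (X, W)"
    by (simp add: power2_norm_eq_inner variation_map_def D)
  also have "tau r (U, Y) \<bullet> tau r (U, Y) = (\<Sum>k<r. \<Sum>i\<in>UNIV. (U k $ i) * (outer (axis i 1) (Y k) \<bullet> tau r (U, Y)))"
    by (subst (1) 1) (simp add: inner_sum_left)
  also have "tau r (X, W) \<bullet> tau r (X, W) = (\<Sum>k<r. \<Sum>j\<in>UNIV. (W k $ j) * (outer (X k) (axis j 1) \<bullet> tau r (X, W)))"
    by (subst (1) 2) (simp add: inner_sum_left)
  finally show ?thesis
    by (simp add: variation_map_def D fst_component_eq_inner[OF f] snd_component_eq_inner[OF e] mult.commute)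
qed

text \<open>Each of the \<open>r (n + m)\<close> terms of the trace formula integrates to half the
  mean deficit. Comparing this with the definition of the deficit leaves a linear equation for
  it.\<close>

lemma variation_mean_deficit:
  fixes G :: "('n::finite, 'm::finite) rep"
  assumes G: "G \<in> reps r"
  shows "(LINT D|variation_measure w r G. w\<^sup>2 - (norm (variation_map r G D))\<^sup>2)
    = 2 * w\<^sup>2 / (real r * (real CARD('n) + real CARD('m)) + 2) * measure (lebesgue_reps r) (variation_set w r G)"
proof -
  obtain X Y where XY: "G = (X, Y)" by (cases G)
  obtain e where e: "\<And>k l. k < r \<Longrightarrow> l < r \<Longrightarrow> e k \<bullet> X l = (if k = l then 1 else 0)"
    using reps_dual_vectors[of X Y r] G XY by metis
  obtain f where f: "\<And>k l. k < r \<Longrightarrow> l < r \<Longrightarrow> f k \<bullet> Y l = (if k = l then 1 else 0)"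
    using reps_dual_vectors[OF reps_swap[of X Y r]] G XY by metis
  let ?N = "variation_measure w r G" and ?\<Phi> = "variation_map r G"
  interpret finite_measure ?N using G by (rule finite_measure_variation)
  define K where "K = (LINT D|?N. w\<^sup>2 - (norm (?\<Phi> D))\<^sup>2)"
  define N where "N = real r * (real CARD('n) + real CARD('m))"
  define vol where "vol = measure (lebesgue_reps r) (variation_set w r G)"
  have single: "tau r (\<lambda>l. if l = k then x else 0, W) = outer x (W k)"
    "tau r (U, \<lambda>l. if l = k then y else 0) = outer (U k) y" if "k < r"
    for k and x :: "real ^ 'n" and y :: "real ^ 'm" and W U
  proof -
    have "(\<Sum>l<r. outer (if l = k then x else 0) (W l)) = (\<Sum>l<r. if l = k then outer x (W k) else 0)"
      "(\<Sum>l<r. outer (U l) (if l = k then y else 0)) = (\<Sum>l<r. if l = k then outer (U k) y else 0)"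
      by (intro sum.cong; simp add: outer_zero)+
    then show "tau r (\<lambda>l. if l = k then x else 0, W) = outer x (W k)"
      "tau r (U, \<lambda>l. if l = k then y else 0) = outer (U k) y"
      using that by (simp_all add: tau_eq_sum_outer)
  qed
  have tz: "tau r (\<lambda>_. 0, W) = 0" "tau r (U, \<lambda>_. 0) = 0" for U :: "nat \<Rightarrow> real ^ 'n" and W :: "nat \<Rightarrow> real ^ 'm"
    by (simp_all add: vec_eq_iff tau_nth)
  \<comment> \<open>The unit variation of one entry of \<open>X\<close> has this image, and its
    pairing with the dual functional is 1, so its moment is exactly \<open>K / 2\<close>.\<close>
  have "variation_map r (X, Y) (\<lambda>l. if l = k then axis i 1 else 0, \<lambda>_. 0) = (outer (axis i 1) (Y k), 0)"
    if "k < r" for k i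
    using that by (simp add: variation_map_def single tz)
  then have m1: "(LINT D|?N. ((outer (axis i 1) (Y k), 0) \<bullet> ?\<Phi> D) * ((outer (axis i 1) (f k), 0) \<bullet> ?\<Phi> D)) = K / 2"
    if "k < r" for k i
    using variation_second_moment[OF G, of w "(\<lambda>l. if l = k then axis i 1 else 0, \<lambda>_. 0)" "(outer (axis i 1) (f k), 0)"] that
    by (simp add: XY inner_outer_outer inner_axis' f K_def)
  have "variation_map r (X, Y) (\<lambda>_. 0, \<lambda>l. if l = k then axis j 1 else 0) = (0, outer (X k) (axis j 1))"
    if "k < r" for k j
    using that by (simp add: variation_map_def single tz)
  then have m2: "(LINT D|?N. ((0, outer (X k) (axis j 1)) \<bullet> ?\<Phi> D) * ((0, outer (e k) (axis j 1)) \<bullet> ?\<Phi> D)) = K / 2"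
    if "k < r" for k j
    using variation_second_moment[OF G, of w "(\<lambda>_. 0, \<lambda>l. if l = k then axis j 1 else 0)" "(0, outer (e k) (axis j 1))"] that
    by (simp add: XY inner_outer_outer inner_axis' e K_def)
  have int: "integrable ?N (\<lambda>D. (p \<bullet> ?\<Phi> D) * (q \<bullet> ?\<Phi> D))" for p q
    by (intro variation_integrable_continuous[OF G, of "\<lambda>x. (p \<bullet> x) * (q \<bullet> x)"] continuous_intros)
  have dec: "(norm (?\<Phi> D))\<^sup>2
      = (\<Sum>k<r. \<Sum>i\<in>UNIV. ((outer (axis i 1) (Y k), 0) \<bullet> ?\<Phi> D) * ((outer (axis i 1) (f k), 0) \<bullet> ?\<Phi> D))
      + (\<Sum>k<r. \<Sum>j\<in>UNIV. ((0, outer (X k) (axis j 1)) \<bullet> ?\<Phi> D) * ((0, outer (e k) (axis j 1)) \<bullet> ?\<Phi> D))" for D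
    unfolding XY by (rule variation_norm_decomposition) (use e f in auto)
  have "(LINT D|?N. (norm (?\<Phi> D))\<^sup>2) = (\<Sum>k<r. \<Sum>i\<in>(UNIV::'n set). K / 2) + (\<Sum>k<r. \<Sum>j\<in>(UNIV::'m set). K / 2)"
    unfolding dec
    by (simp add: Bochner_Integration.integral_add Bochner_Integration.integral_sum int m1 m2)
  also have "\<dots> = N * K / 2" by (simp add: N_def field_simps)
  finally have tr: "(LINT D|?N. (norm (?\<Phi> D))\<^sup>2) = N * K / 2" .
  have "K = (LINT D|?N. w\<^sup>2) - (LINT D|?N. (norm (?\<Phi> D))\<^sup>2)"
    unfolding K_def
    by (intro Bochner_Integration.integral_diff integrable_const
        variation_integrable_continuous[OF G, of "\<lambda>x. (norm x)\<^sup>2"] continuous_intros)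
  then have "K = w\<^sup>2 * vol - N * K / 2"
    using tr measure_variation[OF G, of w] by (simp add: vol_def mult.commute)
  then have "K * (N + 2) = 2 * w\<^sup>2 * vol" by (simp add: field_simps)
  moreover have "N + 2 > 0" by (simp add: N_def add_nonneg_pos)
  ultimately have "K = 2 * w\<^sup>2 / (N + 2) * vol" by (simp add: field_simps)
  then show ?thesis by (simp add: K_def N_def vol_def)
qed

text \<open>As \<open>z\<close> lies in the column space of \<open>X\<close>, the pair of 0 and
  \<open>outer z (axis j 1)\<close> is the image of a variation of \<open>Y\<close> alone. The
  moment identity is applied with it both as direction and as functional.\<close>

lemma variation_row_moment:
  fixes X :: "nat \<Rightarrow> real ^ 'n::finite" and Y :: "nat \<Rightarrow> real ^ 'm::finite"
  assumes G: "(X, Y) \<in> reps r" and z: "z \<in> span (X ` {..<r})"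
  shows "(LINT D|variation_measure w r (X, Y). (\<Sum>k<r. (z \<bullet> X k) * snd D k $ j)\<^sup>2)
    = (norm z)\<^sup>2 * (w\<^sup>2 / (real r * (real CARD('n) + real CARD('m)) + 2))
       * measure (lebesgue_reps r) (variation_set w r (X, Y))"
proof -
  obtain \<alpha> where \<alpha>: "z = (\<Sum>k<r. \<alpha> k *\<^sub>R X k)" using z by (rule span_image_lessThan)
  have "tau r (\<lambda>_. 0, Y) = 0" by (simp add: vec_eq_iff tau_nth)
  moreover have "tau r (X, \<lambda>k. \<alpha> k *\<^sub>R axis j 1) = outer z (axis j 1)"
    by (simp add: \<alpha> outer_sum_left tau_eq_sum_outer outer_scale)
  ultimately have p: "variation_map r (X, Y) (\<lambda>_. 0, \<lambda>k. \<alpha> k *\<^sub>R axis j 1) = (0, outer z (axis j 1))"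
    by (simp add: variation_map_def)
  have row: "(0, outer z (axis j 1)) \<bullet> variation_map r (X, Y) D = (\<Sum>k<r. (z \<bullet> X k) * snd D k $ j)" for D
    by (simp add: variation_map_def inner_outer_tau inner_axis')
  have self: "(0, outer z (axis j 1)) \<bullet> (0 :: real ^ 'm ^ 'n, outer z (axis j 1)) = (norm z)\<^sup>2"
    by (simp add: inner_outer_outer power2_norm_eq_inner inner_axis')
  show ?thesis
    using variation_second_moment[OF G, of w "(\<lambda>_. 0, \<lambda>k. \<alpha> k *\<^sub>R axis j 1)" "(0, outer z (axis j 1))"]
    unfolding p self row variation_mean_deficit[OF G] by (simp add: power2_eq_square)
qed

section \<open>The variational residual\<close>

text \<open>The signs of \<open>B\<close> and \<open>C\<close> run through all four combinations,
  and \<open>E\<close>, being bilinear in the two variations, carries their product. Every mixed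
  product then occurs twice with each sign and cancels.\<close>

lemma sqnorm_on_signs:
  "sqnorm_on P (A + B + C + E) + sqnorm_on P (A - B + C - E)
    + sqnorm_on P (A + B - C - E) + sqnorm_on P (A - B - C + E)
    = 4 * (sqnorm_on P A + sqnorm_on P B + sqnorm_on P C + sqnorm_on P E)"
  unfolding sqnorm_on_def sum.distrib[symmetric] sum_distrib_left
  by (intro sum.cong) (auto simp: power2_eq_square algebra_simps)

lemma sqnorm_on_le:
  fixes T :: "real ^ 'm::finite ^ 'n::finite"
  shows "sqnorm_on P T \<le> real (card P) * (norm T)\<^sup>2"
  unfolding sqnorm_on_def
proof (rule sum_bounded_above, clarify)
  fix i :: 'n and j :: 'm
  have "\<bar>T $ i $ j\<bar> \<le> norm T"
    using Finite_Cartesian_Product.norm_nth_le[of "T $ i" j] Finite_Cartesian_Product.norm_nth_le[of T i] by simp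
  then show "(T $ i $ j)\<^sup>2 \<le> (norm T)\<^sup>2" by (simp add: abs_le_square_iff[symmetric])
qed

lemma sqnorm_on_nonneg: "sqnorm_on P T \<ge> 0"
  by (auto simp: sqnorm_on_def intro!: sum_nonneg)

lemma borel_measurable_sqnorm_on:
  assumes [measurable]: "f \<in> borel_measurable M"
  shows "(\<lambda>D. sqnorm_on P (f D)) \<in> borel_measurable M"
  unfolding sqnorm_on_def case_prod_beta by measurable

lemma variation_integrable_sqnorm_on:
  assumes G: "G \<in> reps r" and T: "T \<in> borel_measurable (lebesgue_reps r)"
    and B: "\<And>D. D \<in> variation_set w r G \<Longrightarrow> norm (T D) \<le> B"
  shows "integrable (variation_measure w r G) (\<lambda>D. sqnorm_on P (T D))"
proof (rule variation_integrable[OF G borel_measurable_sqnorm_on[OF T]])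
  fix D assume "D \<in> variation_set w r G"
  then have "(norm (T D))\<^sup>2 \<le> B\<^sup>2" using B by (intro power_mono) auto
  then have "real (card P) * (norm (T D))\<^sup>2 \<le> real (card P) * B\<^sup>2" by (intro mult_left_mono) auto
  then show "norm (sqnorm_on P (T D)) \<le> real (card P) * B\<^sup>2"
    using sqnorm_on_le[of P "T D"] sqnorm_on_nonneg[of P "T D"] by simp
qed

abbreviation rep_signs :: "nat \<Rightarrow> real \<Rightarrow> real \<Rightarrow> ('n::finite, 'm::finite) rep \<Rightarrow> ('n, 'm) rep" where
  "rep_signs r c d \<equiv> rep_affine r c d (\<lambda>_. 0, \<lambda>_. 0)"

lemma tau_rep_signs:
  "tau r (fst (rep_signs r c d D), Y) = c *\<^sub>R tau r (fst D, Y)"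
  "tau r (X, snd (rep_signs r c d D)) = d *\<^sub>R tau r (X, snd D)"
  "tau r (fst (rep_signs r c d D), snd (rep_signs r c d D)) = (c * d) *\<^sub>R tau r (fst D, snd D)"
  by (cases D, simp_all add: rep_affine_def vec_eq_iff tau_nth sum_distrib_left mult_ac)+

text \<open>A sign change preserves Lebesgue measure and the norm of \<open>variation_map\<close>,
  hence also the variation set.\<close>

lemma variation_integral_signs:
  fixes h :: "('n::finite, 'm::finite) rep \<Rightarrow> real"
  assumes G: "G \<in> reps r" and [measurable]: "h \<in> borel_measurable (lebesgue_reps r)"
    and cd: "\<bar>c\<bar> = 1" "\<bar>d\<bar> = 1"
  shows "(LINT D|variation_measure w r G. h (rep_signs r c d D)) = (LINT D|variation_measure w r G. h D)"
proof -
  let ?L = "lebesgue_reps r :: ('n, 'm) rep measure" and ?V = "variation_set w r G" and ?S = "rep_signs r c d"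
  have [measurable]: "?V \<in> sets ?L" using G by (rule variation_set_measure)
  have S [measurable]: "?S \<in> measurable ?L ?L" using cd by (rule distr_rep_affine)
  have norm_S: "norm (variation_map r G (?S D)) = norm (variation_map r G D)" for D
    using cd by (simp add: variation_map_def tau_rep_signs norm_Pair)
  have "(LINT D|variation_measure w r G. h (?S D)) = (LINT D|?L. indicator ?V D * h (?S D))"
    by (simp add: variation_integral[OF G, symmetric] set_lebesgue_integral_def)
  also have "\<dots> = (LINT D|?L. indicator ?V (?S D) * h (?S D))"
    using measurable_space[OF S]
    by (intro Bochner_Integration.integral_cong) (auto simp: variation_set_eq norm_S indicator_def)
  also have "\<dots> = (LINT D|distr ?L ?L ?S. indicator ?V D * h D)"
    by (rule integral_distr[symmetric]) measurable
  also have "\<dots> = (LINT D|?L. indicator ?V D * h D)"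
    by (simp add: distr_rep_affine(2)[OF cd])
  also have "\<dots> = (LINT D|variation_measure w r G. h D)"
    by (simp add: variation_integral[OF G, symmetric] set_lebesgue_integral_def)
  finally show ?thesis .
qed

lemma tau_add_add:
  "tau r (\<lambda>k. U k + U' k, \<lambda>k. W k + W' k) = tau r (U, W) + tau r (U', W) + tau r (U, W') + tau r (U', W')"
  by (simp add: vec_eq_iff tau_nth sum.distrib distrib_left distrib_right)

text \<open>Averaging over the four sign changes \<open>(\<plusminus>\<Delta>X, \<plusminus>\<Delta>Y)\<close>, which preserve the variation set,
  removes all mixed terms.\<close>

lemma vres_eq_sum_squares:
  fixes X :: "nat \<Rightarrow> real ^ 'n::finite" and Y :: "nat \<Rightarrow> real ^ 'm::finite"
  assumes G: "(X, Y) \<in> reps r"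
  shows "vres w M P r (X, Y) (X', Y)
    = measure (lebesgue_reps r) (variation_set w r (X, Y)) * sqnorm_on P (tau r (X', Y) - M)
    + (LINT D|variation_measure w r (X, Y). sqnorm_on P (tau r (X', snd D)))
    + (LINT D|variation_measure w r (X, Y). sqnorm_on P (tau r (fst D, Y)) + sqnorm_on P (tau r D))"
proof -
  let ?L = "lebesgue_reps r :: ('n, 'm) rep measure" and ?N = "variation_measure w r (X, Y)"
    and ?V = "variation_set w r (X, Y)"
  interpret finite_measure ?N using G by (rule finite_measure_variation)
  define A where "A = tau r (X', Y) - M"
  define B where "B D = tau r (fst D, Y)" for D :: "('n, 'm) rep"
  define C where "C D = tau r (X', snd D)" for D :: "('n, 'm) rep"
  define E where "E D = tau r (fst D, snd D)" for D :: "('n, 'm) rep"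
  note defs = A_def B_def C_def E_def
  obtain c where c: "c \<ge> 0" "\<And>D k. k < r \<Longrightarrow> norm (fst D k) \<le> c * norm (variation_map r (X, Y) D)"
    "\<And>D k. k < r \<Longrightarrow> norm (snd D k) \<le> c * norm (variation_map r (X, Y) D)"
    using variation_bounded[OF G] by metis
  define b where "b = c * \<bar>w\<bar>"
  have b: "b \<ge> 0" using c(1) by (simp add: b_def)
  have bound: "norm (fst D k) \<le> b" "norm (snd D k) \<le> b" if "D \<in> ?V" "k < r" for D k
  proof -
    have "c * norm (variation_map r (X, Y) D) \<le> b"
      unfolding b_def using that c(1)
      by (intro mult_left_mono) (auto simp: variation_set_eq abs_le_square_iff[symmetric])
    then show "norm (fst D k) \<le> b" "norm (snd D k) \<le> b"
      using c(2,3)[OF that(2), of D] by linarith+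
  qed
  have meas [measurable]: "B \<in> borel_measurable ?L" "C \<in> borel_measurable ?L" "E \<in> borel_measurable ?L"
    unfolding B_def C_def E_def by (intro borel_measurable_tau; simp)+
  define bB where "bB = (\<Sum>k<r. b * norm (Y k))"
  define bC where "bC = (\<Sum>k<r. norm (X' k) * b)"
  define bE where "bE = (\<Sum>k<r. b * b)"
  have bnd: "norm (B D) \<le> bB" "norm (C D) \<le> bC" "norm (E D) \<le> bE" if "D \<in> ?V" for D
    unfolding B_def C_def E_def bB_def bC_def bE_def
    by (intro order_trans[OF norm_tau_le] sum_mono mult_mono; use bound[OF that] b in simp)+
  \<comment> \<open>The residual integrand after multiplying the variation of \<open>X\<close> by
    \<open>c\<close> and that of \<open>Y\<close> by \<open>d\<close>. By invariance its integral is
    the same for all four choices of signs.\<close>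
  define h where "h c d D = sqnorm_on P (A + c *\<^sub>R B D + d *\<^sub>R C D + (c * d) *\<^sub>R E D)" for c d D
  have h_meas: "h c d \<in> borel_measurable ?L" for c d
    unfolding h_def by (intro borel_measurable_sqnorm_on) measurable
  have h_signs: "h 1 1 (rep_signs r c d D) = h c d D" for c d D
    unfolding h_def B_def C_def E_def tau_rep_signs by (simp add: mult.commute[of d c])
  have h_int: "integrable ?N (h c d)" if "\<bar>c\<bar> = 1" "\<bar>d\<bar> = 1" for c d
    unfolding h_def
  proof (rule variation_integrable_sqnorm_on[OF G])
    show "(\<lambda>D. A + c *\<^sub>R B D + d *\<^sub>R C D + (c * d) *\<^sub>R E D) \<in> borel_measurable ?L" by measurable
    fix D assume D: "D \<in> ?V"
    have "norm (A + c *\<^sub>R B D + d *\<^sub>R C D + (c * d) *\<^sub>R E D)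
        \<le> norm A + norm (c *\<^sub>R B D) + norm (d *\<^sub>R C D) + norm ((c * d) *\<^sub>R E D)"
      by (intro order_trans[OF norm_triangle_ineq] add_mono order_refl)
    also have "\<dots> \<le> norm A + bB + bC + bE"
      using bnd[OF D] that by (simp add: abs_mult)
    finally show "norm (A + c *\<^sub>R B D + d *\<^sub>R C D + (c * d) *\<^sub>R E D) \<le> norm A + bB + bC + bE" .
  qed
  have ints: "integrable ?N (\<lambda>D. sqnorm_on P (B D))" "integrable ?N (\<lambda>D. sqnorm_on P (C D))"
    "integrable ?N (\<lambda>D. sqnorm_on P (E D))"
    by (rule variation_integrable_sqnorm_on[OF G meas(1) bnd(1)] variation_integrable_sqnorm_on[OF G meas(2) bnd(2)]
        variation_integrable_sqnorm_on[OF G meas(3) bnd(3)]; assumption)+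
  have h_eq: "(LINT D|?N. h c d D) = (LINT D|?N. h 1 1 D)" if "\<bar>c\<bar> = 1" "\<bar>d\<bar> = 1" for c d
    using variation_integral_signs[OF G h_meas[of 1 1] that] by (simp add: h_signs)
  have "vres w M P r (X, Y) (X', Y) = (LINT D|?N. h 1 1 D)"
    unfolding vres_def prod.case variation_integral[OF G]
    by (rule Bochner_Integration.integral_cong) (simp_all add: h_def tau_add_add defs algebra_simps)
  moreover have "4 * (LINT D|?N. h 1 1 D)
      = (LINT D|?N. h 1 1 D) + (LINT D|?N. h (-1) 1 D) + (LINT D|?N. h 1 (-1) D) + (LINT D|?N. h (-1) (-1) D)"
    using h_eq[of "-1" 1] h_eq[of 1 "-1"] h_eq[of "-1" "-1"] by simp
  moreover have "\<dots> = (LINT D|?N. h 1 1 D + h (-1) 1 D + h 1 (-1) D + h (-1) (-1) D)"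
    using h_int by (simp add: Bochner_Integration.integral_add)
  moreover have "\<dots> = (LINT D|?N. 4 * (sqnorm_on P A + sqnorm_on P (C D) + (sqnorm_on P (B D) + sqnorm_on P (E D))))"
  proof (rule Bochner_Integration.integral_cong[OF refl])
    show "h 1 1 D + h (-1) 1 D + h 1 (-1) D + h (-1) (-1) D
        = 4 * (sqnorm_on P A + sqnorm_on P (C D) + (sqnorm_on P (B D) + sqnorm_on P (E D)))" for D
      using sqnorm_on_signs[of P A "B D" "C D" "E D"] by (simp add: h_def)
  qed
  moreover have "\<dots> = 4 * (LINT D|?N. sqnorm_on P A + sqnorm_on P (C D) + (sqnorm_on P (B D) + sqnorm_on P (E D)))"
    by (rule integral_mult_right_zero)
  moreover have "(LINT D|?N. sqnorm_on P A + sqnorm_on P (C D) + (sqnorm_on P (B D) + sqnorm_on P (E D)))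
      = measure ?N (space ?N) * sqnorm_on P A + (LINT D|?N. sqnorm_on P (C D))
        + (LINT D|?N. sqnorm_on P (B D) + sqnorm_on P (E D))"
    using ints by (simp add: Bochner_Integration.integral_add)
  ultimately show ?thesis
    by (simp add: measure_variation[OF G] defs)
qed

text \<open>The dual vectors turn row \<open>i\<close> of \<open>X'\<close> into one vector of the
  column space of \<open>X\<close>, to which the row moment applies once for each sampled entry. The
  constant \<open>\<kappa>\<close> is obtained before \<open>X'\<close> is chosen, so it does not
  affect minimisers.\<close>

lemma vres_formula:
  fixes X :: "nat \<Rightarrow> real ^ 'n::finite" and Y :: "nat \<Rightarrow> real ^ 'm::finite"
  assumes G: "(X, Y) \<in> reps r"
    and e_span: "\<And>k. k < r \<Longrightarrow> e k \<in> span (X ` {..<r})"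
    and e: "\<And>k l. k < r \<Longrightarrow> l < r \<Longrightarrow> e k \<bullet> X l = (if k = l then 1 else 0)"
  obtains \<kappa> where "\<And>X'. vres w M P r (X, Y) (X', Y)
    = measure (lebesgue_reps r) (variation_set w r (X, Y)) * (sqnorm_on P (tau r (X', Y) - M)
      + w\<^sup>2 / (real r * (real CARD('n) + real CARD('m)) + 2)
        * (\<Sum>(i, j)\<in>P. (norm (\<Sum>k<r. X' k $ i *\<^sub>R e k))\<^sup>2)) + \<kappa>"
proof (rule that)
  fix X' :: "nat \<Rightarrow> real ^ 'n"
  let ?N = "variation_measure w r (X, Y)" and ?vol = "measure (lebesgue_reps r) (variation_set w r (X, Y))"
  let ?c = "w\<^sup>2 / (real r * (real CARD('n) + real CARD('m)) + 2)"
  define z where "z i = (\<Sum>k<r. X' k $ i *\<^sub>R e k)" for i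
  have z_span: "z i \<in> span (X ` {..<r})" for i
    unfolding z_def by (intro span_sum span_scale e_span) auto
  have zX: "z i \<bullet> X l = X' l $ i" if "l < r" for i l
  proof -
    have "z i \<bullet> X l = (\<Sum>k<r. if k = l then X' k $ i else 0)"
      unfolding z_def inner_sum_left using e that by (intro sum.cong) auto
    then show ?thesis using that by simp
  qed
  have entry: "tau r (X', snd D) $ i $ j = (\<Sum>k<r. (z i \<bullet> X k) * snd D k $ j)" for i j and D :: "('n, 'm) rep"
    by (simp add: tau_nth zX)
  have row: "(\<Sum>k<r. (z i \<bullet> X k) * snd D k $ j) = (0, outer (z i) (axis j 1)) \<bullet> variation_map r (X, Y) D"
    for i j and D :: "('n, 'm) rep"
    by (simp add: variation_map_def inner_outer_tau inner_axis')
  have int: "integrable ?N (\<lambda>D. (tau r (X', snd D) $ i $ j)\<^sup>2)" for i j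
    unfolding entry row
    by (intro variation_integrable_continuous[OF G, of "\<lambda>x. ((0, outer (z i) (axis j 1)) \<bullet> x)\<^sup>2"] continuous_intros)
  have "(LINT D|?N. sqnorm_on P (tau r (X', snd D))) = (\<Sum>(i, j)\<in>P. LINT D|?N. (tau r (X', snd D) $ i $ j)\<^sup>2)"
    unfolding sqnorm_on_def case_prod_beta using int by (simp add: Bochner_Integration.integral_sum)
  also have "\<dots> = (\<Sum>(i, j)\<in>P. (norm (z i))\<^sup>2 * ?c * ?vol)"
    unfolding entry by (simp add: variation_row_moment[OF G z_span])
  also have "\<dots> = ?vol * (?c * (\<Sum>(i, j)\<in>P. (norm (z i))\<^sup>2))"
    by (simp add: sum_distrib_left sum_divide_distrib case_prod_beta mult_ac)
  finally show "vres w M P r (X, Y) (X', Y)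
    = ?vol * (sqnorm_on P (tau r (X', Y) - M) + ?c * (\<Sum>(i, j)\<in>P. (norm (\<Sum>k<r. X' k $ i *\<^sub>R e k))\<^sup>2))
      + (LINT D|?N. sqnorm_on P (tau r (fst D, Y)) + sqnorm_on P (tau r D))"
    unfolding vres_eq_sum_squares[OF G] by (simp add: z_def distrib_left)
qed

section \<open>Ridge regression\<close>

definition coord_mask :: "'m set \<Rightarrow> real ^ 'm \<Rightarrow> real ^ 'm" where
  "coord_mask S u = (\<chi> j. of_bool (j \<in> S) * u $ j)"

text \<open>Half the gradient in \<open>z\<close> of the functional that sums
  \<open>((z v* A) $ j - v $ j)\<close> squared over \<open>j \<in> S\<close> and adds
  \<open>l\<close> times the squared norm of \<open>z\<close>.\<close>

definition ridge_gradient :: "'m::finite set \<Rightarrow> real \<Rightarrow> real ^ 'm \<Rightarrow> real ^ 'm ^ 'n \<Rightarrow> real ^ 'n \<Rightarrow> real ^ 'n::finite" where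
  "ridge_gradient S l v A z = A *v coord_mask S (z v* A - v) + l *\<^sub>R z"

text \<open>The minimiser is encoded as a critical point. For \<open>l > 0\<close> strong convexity
  makes it unique, so the choice is determined.\<close>

definition ridge :: "'m::finite set \<Rightarrow> real \<Rightarrow> real ^ 'm \<Rightarrow> real ^ 'm ^ 'n \<Rightarrow> real ^ 'n::finite" where
  "ridge S l v A = (SOME z. ridge_gradient S l v A z = 0)"

lemma vector_matrix_mult_add: "(x + y) v* (A :: real ^ 'm ^ 'n) = x v* A + y v* A"
  by (simp add: vector_matrix_mult_def vec_eq_iff sum.distrib algebra_simps)

lemma vector_matrix_mult_scaleR: "(c *\<^sub>R x) v* (A :: real ^ 'm ^ 'n) = c *\<^sub>R (x v* A)"
  by (simp add: vector_matrix_mult_def vec_eq_iff sum_distrib_left algebra_simps)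

lemma coord_mask_add: "coord_mask S (u + w) = coord_mask S u + coord_mask S w"
  by (simp add: coord_mask_def vec_eq_iff algebra_simps)

lemma coord_mask_scaleR: "coord_mask S (c *\<^sub>R u) = c *\<^sub>R coord_mask S u"
  by (simp add: coord_mask_def vec_eq_iff)

lemma inner_coord_mask: "coord_mask S u \<bullet> w = (\<Sum>j\<in>S. u $ j * w $ j)" for S :: "'m::finite set"
proof -
  have "coord_mask S u \<bullet> w = (\<Sum>j\<in>UNIV. if j \<in> S then u $ j * w $ j else 0)"
    unfolding coord_mask_def inner_vec_def by (intro sum.cong) auto
  then show ?thesis by (simp add: sum.If_cases)
qed

lemma inner_matrix_coord_mask: "(A *v coord_mask S u) \<bullet> d = (\<Sum>j\<in>S. u $ j * (d v* A) $ j)"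
  using dot_lmul_matrix[of d A "coord_mask S u"] by (simp add: inner_commute inner_coord_mask[symmetric])

lemma ridge_gradient_shift:
  "ridge_gradient S l v A (z + d) = ridge_gradient S l v A z + (A *v coord_mask S (d v* A) + l *\<^sub>R d)"
proof -
  have "(z + d) v* A - v = (z v* A - v) + d v* A" by (simp add: vector_matrix_mult_add)
  then have "A *v coord_mask S ((z + d) v* A - v) = A *v coord_mask S (z v* A - v) + A *v coord_mask S (d v* A)"
    by (simp only: coord_mask_add matrix_vector_right_distrib)
  then show ?thesis by (simp add: ridge_gradient_def scaleR_add_right)
qed

text \<open>The masked term contributes a sum of squares. This one inequality yields both
  solvability and continuity of \<open>ridge\<close>.\<close>

lemma ridge_coercive: "l * (norm d)\<^sup>2 \<le> (A *v coord_mask S (d v* A) + l *\<^sub>R d) \<bullet> d"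
  by (simp add: inner_add_left inner_matrix_coord_mask power2_norm_eq_inner sum_nonneg)

text \<open>The gradient is affine in \<open>z\<close>. Coercivity makes its linear part injective,
  hence surjective in finite dimension, so a zero exists.\<close>

lemma ridge_gradient_ridge:
  assumes l: "l > 0"
  shows "ridge_gradient S l v A (ridge S l v A) = 0"
proof -
  let ?f = "\<lambda>d. A *v coord_mask S (d v* A) + l *\<^sub>R d"
  have lin: "linear ?f"
    by (rule linearI) (simp_all add: vector_matrix_mult_add vector_matrix_mult_scaleR coord_mask_add coord_mask_scaleR
        matrix_vector_right_distrib scaleR_add_right matrix_vector_mult_scaleR)
  have "inj ?f"
    unfolding linear_injective_0[OF lin]
  proof (intro allI impI)
    fix d assume "?f d = 0"
    then have "l * (norm d)\<^sup>2 \<le> 0" using ridge_coercive[of l d A S] by simp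
    then show "d = 0" using l by (simp add: mult_le_0_iff)
  qed
  then have "surj ?f" by (rule linear_inj_imp_surj[OF lin])
  then obtain z where "- ridge_gradient S l v A 0 = ?f z" using surjD[of ?f] by blast
  then have "ridge_gradient S l v A (0 + z) = 0"
    unfolding ridge_gradient_shift[of S l v A 0 z] by (metis add.right_inverse)
  then show ?thesis unfolding ridge_def by (rule someI)
qed

text \<open>Expanding the quadratic functional around the critical point, the linear term vanishes.
  The quadratic remainder is a sum of squares plus the penalty of the displacement.\<close>

lemma ridge_objective:
  fixes A :: "real ^ 'm::finite ^ 'n::finite" and S v l y
  assumes l: "l > 0"
  defines "z \<equiv> ridge S l v A"
  shows "(\<Sum>j\<in>S. ((y v* A) $ j - v $ j)\<^sup>2) + l * (norm y)\<^sup>2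
    \<ge> (\<Sum>j\<in>S. ((z v* A) $ j - v $ j)\<^sup>2) + l * (norm z)\<^sup>2 + l * (norm (y - z))\<^sup>2"
proof -
  define d where "d = y - z"
  have y: "y = z + d" by (simp add: d_def)
  have "0 = ridge_gradient S l v A z \<bullet> d" by (simp add: z_def ridge_gradient_ridge[OF l])
  then have cross: "(\<Sum>j\<in>S. ((z v* A) $ j - v $ j) * (d v* A) $ j) + l * (z \<bullet> d) = 0"
    by (simp add: ridge_gradient_def inner_add_left inner_matrix_coord_mask)
  have "(\<Sum>j\<in>S. ((y v* A) $ j - v $ j)\<^sup>2)
      = (\<Sum>j\<in>S. ((z v* A) $ j - v $ j)\<^sup>2 + 2 * (((z v* A) $ j - v $ j) * (d v* A) $ j) + ((d v* A) $ j)\<^sup>2)"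
    unfolding y by (intro sum.cong refl) (simp add: vector_matrix_mult_add power2_eq_square algebra_simps)
  also have "\<dots> = (\<Sum>j\<in>S. ((z v* A) $ j - v $ j)\<^sup>2) + 2 * (\<Sum>j\<in>S. ((z v* A) $ j - v $ j) * (d v* A) $ j)
      + (\<Sum>j\<in>S. ((d v* A) $ j)\<^sup>2)"
    by (simp add: sum.distrib sum_distrib_left)
  finally have 1: "(\<Sum>j\<in>S. ((y v* A) $ j - v $ j)\<^sup>2) = \<dots>" .
  have 2: "l * (norm y)\<^sup>2 = l * (norm z)\<^sup>2 + 2 * (l * (z \<bullet> d)) + l * (norm d)\<^sup>2"
    unfolding y by (simp add: power2_norm_eq_inner inner_add_left inner_add_right inner_commute algebra_simps)
  have "(\<Sum>j\<in>S. ((d v* A) $ j)\<^sup>2) \<ge> 0" by (simp add: sum_nonneg)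
  with 1 2 cross show ?thesis unfolding d_def[symmetric] by linarith
qed

lemma continuous_ridge_gradient: "continuous_on UNIV (\<lambda>A. ridge_gradient S l v A z)"
  unfolding ridge_gradient_def coord_mask_def matrix_vector_mult_def vector_matrix_mult_def
  by (intro continuous_intros continuous_on_vec_lambda) 

text \<open>Coercivity at \<open>B\<close> bounds the distance of the two minimisers by the gradient
  at the old minimiser divided by \<open>l\<close>. That gradient is continuous in \<open>B\<close>
  and vanishes at \<open>B = A\<close>; the factor \<open>1 / l\<close> is independent of the
  matrix, so jumps of the rank do no harm.\<close>

lemma continuous_ridge:
  fixes v :: "real ^ 'm::finite"
  assumes l: "l > 0"
  shows "continuous_on UNIV (ridge S l v :: real ^ 'm ^ 'n::finite \<Rightarrow> _)"
proof (rule continuous_at_imp_continuous_on, clarify)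
  fix A :: "real ^ 'm ^ 'n"
  let ?z = "ridge S l v"
  have bound: "norm (?z B - ?z A) \<le> norm (ridge_gradient S l v B (?z A)) / l" for B
  proof -
    define d where "d = ?z A - ?z B"
    have "ridge_gradient S l v B (?z B + d) = B *v coord_mask S (d v* B) + l *\<^sub>R d"
      unfolding ridge_gradient_shift by (simp add: ridge_gradient_ridge[OF l])
    then have g: "ridge_gradient S l v B (?z A) = B *v coord_mask S (d v* B) + l *\<^sub>R d"
      by (simp add: d_def)
    have "l * (norm d)\<^sup>2 \<le> ridge_gradient S l v B (?z A) \<bullet> d"
      unfolding g by (rule ridge_coercive)
    also have "\<dots> \<le> norm (ridge_gradient S l v B (?z A)) * norm d" by (rule norm_cauchy_schwarz)
    finally have "l * norm d \<le> norm (ridge_gradient S l v B (?z A))"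
      by (cases "d = 0") (auto simp: power2_eq_square)
    then show ?thesis using l by (simp add: d_def norm_minus_commute field_simps)
  qed
  have "isCont (\<lambda>B. ridge_gradient S l v B (?z A)) A"
    using continuous_ridge_gradient[of S l v "?z A"] by (simp add: continuous_on_eq_continuous_at)
  then have "((\<lambda>B. norm (ridge_gradient S l v B (?z A)) / l) \<longlongrightarrow> norm (ridge_gradient S l v A (?z A)) / l) (at A)"
    unfolding isCont_def using l by (intro tendsto_intros) auto
  then have "((\<lambda>B. norm (ridge_gradient S l v B (?z A)) / l) \<longlongrightarrow> 0) (at A)"
    by (simp add: ridge_gradient_ridge[OF l])
  then have "((\<lambda>B. ?z B - ?z A) \<longlongrightarrow> 0) (at A)"
    by (rule Lim_null_comparison[rotated]) (simp add: bound)
  then show "isCont ?z A" by (simp add: isCont_def LIM_zero_iff)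
qed

text \<open>The value \<open>1\<close> for rows without sample is arbitrary: it makes \<open>ridge\<close> vanish there, as
  the minimal norm convention demands.\<close>

definition row_weight :: "('n \<times> 'm) set \<Rightarrow> real \<Rightarrow> 'n \<Rightarrow> real" where
  "row_weight P c i = (if P `` {i} = {} then 1 else c * real (card (P `` {i})))"

definition ridge_update :: "real ^ 'm ^ 'n \<Rightarrow> ('n::finite \<times> 'm::finite) set \<Rightarrow> real \<Rightarrow> real ^ 'm ^ 'n \<Rightarrow> real ^ 'm ^ 'n" where
  "ridge_update M P c A = (\<chi> i. ridge (P `` {i}) (row_weight P c i) (M $ i) A v* A)"

lemma row_weight_pos: "c > 0 \<Longrightarrow> row_weight P c i > 0" for P :: "('n::finite \<times> 'm::finite) set"
  by (simp add: row_weight_def card_gt_0_iff)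

lemma continuous_ridge_update:
  fixes P :: "('n::finite \<times> 'm::finite) set"
  assumes "c > 0"
  shows "continuous_on UNIV (ridge_update M P c)"
  unfolding ridge_update_def[abs_def] vector_matrix_mult_def
  by (intro continuous_intros continuous_on_vec_lambda continuous_ridge row_weight_pos assms)

lemma ridge_update_zero: "ridge_update M P c 0 = 0"
  by (simp add: ridge_update_def vec_eq_iff vector_matrix_mult_def)

text \<open>With an empty mask and weight 1 the gradient is \<open>z\<close> itself, so its zero is
  0.\<close>

lemma ridge_update_empty_row:
  fixes A :: "real ^ 'm::finite ^ 'n::finite"
  assumes "P `` {i} = {}"
  shows "ridge_update M P c A $ i = 0"
proof -
  have "coord_mask {} u = 0" for u :: "real ^ 'm" by (simp add: coord_mask_def vec_eq_iff)
  then have "ridge {} 1 (M $ i) A = 0"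
    using ridge_gradient_ridge[of 1 "{}" "M $ i" A] by (simp add: ridge_gradient_def)
  then show ?thesis
    using assms by (simp add: ridge_update_def row_weight_def vec_eq_iff vector_matrix_mult_def)
qed

section \<open>Ridge minimisers in terms of the factors\<close>

lemma vector_matrix_mult_tau: "(z v* tau r (X, Y)) $ j = (\<Sum>k<r. (z \<bullet> X k) * Y k $ j)"
proof -
  have "(z v* tau r (X, Y)) $ j = (\<Sum>i\<in>UNIV. \<Sum>k<r. z $ i * (X k $ i * Y k $ j))"
    by (simp add: vector_matrix_mult_def tau_nth sum_distrib_left mult_ac)
  also have "\<dots> = (\<Sum>k<r. \<Sum>i\<in>UNIV. z $ i * (X k $ i * Y k $ j))" by (rule sum.swap)
  finally show ?thesis by (simp add: inner_vec_def sum_distrib_left mult_ac)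
qed

lemma tau_mult_vec_in_span: "tau r (X, Y) *v u \<in> span (X ` {..<r})"
proof -
  have "(tau r (X, Y) *v u) $ i = (\<Sum>k<r. (Y k \<bullet> u) *\<^sub>R X k) $ i" for i
  proof -
    have "(tau r (X, Y) *v u) $ i = (\<Sum>j\<in>UNIV. \<Sum>k<r. X k $ i * (Y k $ j * u $ j))"
      by (simp add: matrix_vector_mult_def tau_nth sum_distrib_right sum_distrib_left mult_ac)
    also have "\<dots> = (\<Sum>k<r. \<Sum>j\<in>UNIV. X k $ i * (Y k $ j * u $ j))" by (rule sum.swap)
    finally show ?thesis by (simp add: inner_vec_def sum_distrib_left mult_ac)
  qed
  then have "tau r (X, Y) *v u = (\<Sum>k<r. (Y k \<bullet> u) *\<^sub>R X k)" unfolding vec_eq_iff by blast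
  also have "\<dots> \<in> span (X ` {..<r})" by (intro span_sum span_scale span_base) auto
  finally show ?thesis .
qed

text \<open>Vanishing of the gradient writes \<open>l\<close> times the minimiser as the matrix
  applied to a vector. Thus minimising over the whole space agrees with minimising over the column
  space, which is all that a factor can represent.\<close>

lemma ridge_in_span:
  assumes "l > 0"
  shows "ridge S l v (tau r (X, Y)) \<in> span (X ` {..<r})"
proof -
  let ?z = "ridge S l v (tau r (X, Y))" and ?u = "coord_mask S (ridge S l v (tau r (X, Y)) v* tau r (X, Y) - v)"
  have "l *\<^sub>R ?z = - (tau r (X, Y) *v ?u)"
    using ridge_gradient_ridge[OF assms, of S v "tau r (X, Y)"]
    unfolding ridge_gradient_def by (rule iffD1[OF add_eq_0_iff])
  then have "l *\<^sub>R ?z \<in> span (X ` {..<r})" by (simp only: span_neg tau_mult_vec_in_span)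
  then have "(1 / l) *\<^sub>R l *\<^sub>R ?z \<in> span (X ` {..<r})" by (rule span_scale)
  then show ?thesis using assms by simp
qed

text \<open>The difference of the two sides lies in the span and is orthogonal to its generators,
  hence to itself.\<close>

lemma dual_expansion:
  fixes X :: "nat \<Rightarrow> 'a::euclidean_space"
  assumes e_span: "\<And>k. k < r \<Longrightarrow> e k \<in> span (X ` {..<r})"
    and e: "\<And>k l. k < r \<Longrightarrow> l < r \<Longrightarrow> e k \<bullet> X l = (if k = l then 1 else 0)"
    and z: "z \<in> span (X ` {..<r})"
  shows "(\<Sum>k<r. (z \<bullet> X k) *\<^sub>R e k) = z"
proof -
  define d where "d = z - (\<Sum>k<r. (z \<bullet> X k) *\<^sub>R e k)"
  have "d \<bullet> X l = 0" if l: "l < r" for l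
  proof -
    have "(\<Sum>k<r. (z \<bullet> X k) * (e k \<bullet> X l)) = (\<Sum>k<r. if k = l then z \<bullet> X k else 0)"
      using e l by (intro sum.cong) auto
    then show ?thesis using l by (simp add: d_def inner_diff_left inner_sum_left)
  qed
  then have "orthogonal d x" if "x \<in> span (X ` {..<r})" for x
    by (intro orthogonal_to_span[OF that]) (auto simp: orthogonal_def)
  moreover have "d \<in> span (X ` {..<r})"
    unfolding d_def using z by (intro span_diff span_sum span_scale e_span) auto
  ultimately have "d \<bullet> d = 0" by (simp add: orthogonal_def)
  then have "d = 0" by simp
  then show ?thesis unfolding d_def right_minus_eq by (rule sym)
qed

lemma sum_rows:
  fixes P :: "('n::finite \<times> 'm::finite) set"
  shows "(\<Sum>(i, j)\<in>P. f i j) = (\<Sum>i\<in>UNIV. \<Sum>j\<in>P `` {i}. f i j)"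
proof -
  have "(\<Sum>(i, j)\<in>P. f i j) = (\<Sum>(i, j)\<in>Sigma UNIV (\<lambda>i. P `` {i}). f i j)"
    by (rule sum.cong) auto
  then show ?thesis by (simp add: sum.Sigma)
qed

section \<open>The two methods\<close>

text \<open>The scaling of \<open>omega\<close> cancels the rank in the moment constant. The penalty
  is therefore the same for every \<open>r\<close>, so that one function of the product serves all
  ranks.\<close>

lemma omega_squared:
  "(omega TYPE('n::finite) TYPE('m::finite) wt r)\<^sup>2 / (real r * (real CARD('n) + real CARD('m)) + 2)
    = wt\<^sup>2 / (real CARD('n) + real CARD('m))"
proof -
  have pos: "real CARD('n) + real CARD('m) > 0" by (simp add: add_pos_pos)
  have "real r * (real CARD('n) + real CARD('m)) + 2 > 0" by (intro add_nonneg_pos) auto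
  moreover have "(omega TYPE('n) TYPE('m) wt r)\<^sup>2
      = wt\<^sup>2 * (real r * (real CARD('n) + real CARD('m)) + 2) / (real CARD('n) + real CARD('m))"
    unfolding omega_def by (rule real_sqrt_pow2) simp
  ultimately show ?thesis by simp
qed

lemma omega_nonzero: "wt > 0 \<Longrightarrow> omega TYPE('n::finite) TYPE('m::finite) wt r \<noteq> 0"
proof -
  assume "wt > 0"
  moreover have "real r * (real CARD('n) + real CARD('m)) + 2 > 0" by (intro add_nonneg_pos) auto
  ultimately show ?thesis by (simp add: omega_def add_nonneg_eq_0_iff)
qed

text \<open>\<open>T - T'\<close> is orthogonal to \<open>T'\<close>, so its squared norm is the
  difference of the squared norms. This settles the selection of smallest norm: rows without samples
  must vanish.\<close>

lemma eq_if_norm_le_and_rows_agree: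
  fixes T T' :: "real ^ 'm::finite ^ 'n::finite"
  assumes agree: "\<And>i. i \<in> I \<Longrightarrow> T $ i = T' $ i" and zero: "\<And>i. i \<notin> I \<Longrightarrow> T' $ i = 0"
    and le: "norm T \<le> norm T'"
  shows "T = T'"
proof -
  have "T $ i \<bullet> T' $ i = T' $ i \<bullet> T' $ i" for i
    using agree zero by (cases "i \<in> I") auto
  then have "T \<bullet> T' = T' \<bullet> T'" by (simp add: inner_vec_def[of _ T'])
  then have "(norm (T - T'))\<^sup>2 = (norm T)\<^sup>2 - (norm T')\<^sup>2"
    by (simp add: power2_norm_eq_inner inner_diff_left inner_diff_right inner_commute)
  also have "\<dots> \<le> 0" using power_mono[OF le, of 2] by simp
  finally show ?thesis by simp
qed

text \<open>Up to a positive factor and a constant the residual is a sum of ridge functionals, one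
  per sampled row. Strong convexity fixes the sampled rows of the new product, and the minimal norm
  rule fixes the others.\<close>

lemma tau_meth1:
  fixes M :: "real ^ 'm::finite ^ 'n::finite"
  assumes wt: "wt > 0" and G: "G \<in> reps r"
  shows "tau r (meth1 wt M P r G) = ridge_update M P (wt\<^sup>2 / (real CARD('n) + real CARD('m))) (tau r G)"
proof -
  obtain X Y where XY: "G = (X, Y)" by (cases G)
  have G': "(X, Y) \<in> reps r" using G XY by simp
  obtain e where e_span: "\<And>k. k < r \<Longrightarrow> e k \<in> span (X ` {..<r})"
    and e: "\<And>k l. k < r \<Longrightarrow> l < r \<Longrightarrow> e k \<bullet> X l = (if k = l then 1 else 0)"
    using reps_dual_vectors[OF G'] by metis
  define c where "c = wt\<^sup>2 / (real CARD('n) + real CARD('m))"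
  have c: "c > 0" using wt by (simp add: c_def add_pos_pos)
  define A where "A = tau r (X, Y)"
  define w where "w = omega TYPE('n) TYPE('m) wt r"
  define vol where "vol = measure (lebesgue_reps r) (variation_set w r (X, Y))"
  have vol: "vol > 0"
    unfolding vol_def using G' omega_nonzero[OF wt] by (intro variation_set_measure) (simp_all add: w_def)
  define z where "z X' i = (\<Sum>k<r. X' k $ i *\<^sub>R e k)" for X' :: "nat \<Rightarrow> real ^ 'n" and i
  define J where "J X' = sqnorm_on P (tau r (X', Y) - M) + c * (\<Sum>(i, j)\<in>P. (norm (z X' i))\<^sup>2)" for X'
  have wc: "w\<^sup>2 / (real r * (real CARD('n) + real CARD('m)) + 2) = c"
    unfolding w_def c_def by (rule omega_squared)
  obtain \<kappa> where "\<And>X'. vres w M P r (X, Y) (X', Y)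
    = vol * (sqnorm_on P (tau r (X', Y) - M)
      + w\<^sup>2 / (real r * (real CARD('n) + real CARD('m)) + 2)
        * (\<Sum>(i, j)\<in>P. (norm (\<Sum>k<r. X' k $ i *\<^sub>R e k))\<^sup>2)) + \<kappa>"
    unfolding vol_def by (rule vres_formula[OF G', of e w M P]) (use e_span e in auto)
  then have \<kappa>: "\<And>X'. vres w M P r (X, Y) (X', Y) = vol * J X' + \<kappa>"
    unfolding wc J_def z_def .
  define \<zeta> where "\<zeta> i = ridge (P `` {i}) (row_weight P c i) (M $ i) A" for i
  define R where "R i y = (\<Sum>j\<in>P `` {i}. ((y v* A) $ j - M $ i $ j)\<^sup>2) + row_weight P c i * (norm y)\<^sup>2" for i y
  have row: "(z X' i v* A) $ j = tau r (X', Y) $ i $ j" for X' i j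
  proof -
    have "z X' i \<bullet> X l = X' l $ i" if "l < r" for l
    proof -
      have "z X' i \<bullet> X l = (\<Sum>k<r. if k = l then X' k $ i else 0)"
        unfolding z_def inner_sum_left using e that by (intro sum.cong) auto
      then show ?thesis using that by simp
    qed
    then show ?thesis by (simp add: A_def vector_matrix_mult_tau tau_nth)
  qed
  \<comment> \<open>Rows without samples contribute empty sums. In a sampled row the penalty is
    counted once per sample, which is where the cardinality in \<open>row_weight\<close> comes
    from.\<close>
  have J: "J X' = (\<Sum>i | P `` {i} \<noteq> {}. R i (z X' i))" for X'
  proof -
    have "J X' = (\<Sum>i\<in>UNIV. (\<Sum>j\<in>P `` {i}. (tau r (X', Y) $ i $ j - M $ i $ j)\<^sup>2)
        + c * (\<Sum>j\<in>P `` {i}. (norm (z X' i))\<^sup>2))"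
      unfolding J_def sqnorm_on_def sum_rows by (simp add: sum.distrib sum_distrib_left)
    also have "\<dots> = (\<Sum>i\<in>UNIV. if P `` {i} \<noteq> {} then R i (z X' i) else 0)"
      by (intro sum.cong refl) (auto simp: R_def row row_weight_def)
    finally show ?thesis by (simp add: sum.If_cases)
  qed
  \<comment> \<open>The factor realising all row minimisers at once: its entries are the coordinates
    of \<open>\<zeta> i\<close> in the dual vectors.\<close>
  define Z where "Z = (\<lambda>k\<in>{..<r}. \<chi> i. \<zeta> i \<bullet> X k)"
  have Z_factors: "Z \<in> factors r" by (simp add: Z_def)
  have zZ: "z Z i = \<zeta> i" for i
  proof -
    have "\<zeta> i \<in> span (X ` {..<r})"
      unfolding \<zeta>_def A_def by (intro ridge_in_span row_weight_pos c)
    from dual_expansion[OF e_span e this] show ?thesis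
      by (simp add: z_def Z_def)
  qed
  have R_ge: "R i y \<ge> R i (\<zeta> i) + row_weight P c i * (norm (y - \<zeta> i))\<^sup>2" for i y
    unfolding R_def \<zeta>_def by (intro ridge_objective row_weight_pos c)
  have J_ge: "J X' \<ge> J Z + (\<Sum>i | P `` {i} \<noteq> {}. row_weight P c i * (norm (z X' i - \<zeta> i))\<^sup>2)" for X'
    unfolding J zZ sum.distrib[symmetric] by (intro sum_mono R_ge)
  have pen: "(\<Sum>i | P `` {i} \<noteq> {}. row_weight P c i * (norm (z X' i - \<zeta> i))\<^sup>2) \<ge> 0" for X'
    by (intro sum_nonneg mult_nonneg_nonneg zero_le_power2 less_imp_le[OF row_weight_pos[OF c]])
  define Q where "Q = is_arg_min (\<lambda>X'. vres w M P r (X, Y) (X', Y)) (\<lambda>X'. X' \<in> factors r)"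
  have Q: "Q X' \<longleftrightarrow> X' \<in> factors r \<and> (\<forall>X''\<in>factors r. J X' \<le> J X'')" for X'
    unfolding Q_def is_arg_min_linorder \<kappa> using vol by (auto simp: mult_le_cancel_left_pos)
  have QZ: "Q Z" unfolding Q using Z_factors add_increasing2[OF pen order_refl] J_ge order_trans by blast
  have update_row: "ridge_update M P c A $ i = \<zeta> i v* A" for i
    by (simp add: ridge_update_def \<zeta>_def)
  have tauZ: "tau r (Z, Y) = ridge_update M P c A"
    by (simp add: vec_eq_iff update_row zZ[symmetric] row)
  \<comment> \<open>Comparison with \<open>Z\<close> forces the strong convexity excess to vanish,
    and its weights are positive.\<close>
  have minimal: "tau r (X', Y) $ i = ridge_update M P c A $ i" if "Q X'" "P `` {i} \<noteq> {}" for X' i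
  proof -
    have "J X' \<le> J Z" using that(1) Z_factors by (simp add: Q)
    then have "(\<Sum>i | P `` {i} \<noteq> {}. row_weight P c i * (norm (z X' i - \<zeta> i))\<^sup>2) = 0"
      using J_ge[of X'] pen[of X'] by linarith
    then have "row_weight P c i * (norm (z X' i - \<zeta> i))\<^sup>2 = 0"
      using that(2) less_imp_le[OF row_weight_pos[OF c, of P]]
      by (subst (asm) sum_nonneg_eq_0_iff) auto
    then have "z X' i = \<zeta> i" using row_weight_pos[OF c, of P i] by simp
    then have "tau r (X', Y) $ i $ j = ridge_update M P c A $ i $ j" for j
      using row[of X' i j] by (simp add: update_row)
    then show ?thesis by (simp add: vec_eq_iff)
  qed
  have sel: "tau r (X', Y) = ridge_update M P c A" if "is_arg_min (\<lambda>X'. norm (tau r (X', Y))) Q X'" for X'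
  proof (rule eq_if_norm_le_and_rows_agree[where I="{i. P `` {i} \<noteq> {}}"])
    show "norm (tau r (X', Y)) \<le> norm (ridge_update M P c A)"
      using that QZ unfolding is_arg_min_linorder tauZ[symmetric] by blast
    show "tau r (X', Y) $ i = ridge_update M P c A $ i" if "i \<in> {i. P `` {i} \<noteq> {}}" for i
      using that minimal \<open>is_arg_min _ Q X'\<close> unfolding is_arg_min_linorder by blast
    show "ridge_update M P c A $ i = 0" if "i \<notin> {i. P `` {i} \<noteq> {}}" for i
      using that by (intro ridge_update_empty_row) simp
  qed
  \<comment> \<open>Since \<open>arg_min\<close> is a choice, a minimiser has to be exhibited before
    the chosen element is known to be one.\<close>
  have "is_arg_min (\<lambda>X'. norm (tau r (X', Y))) Q Z"
    unfolding is_arg_min_linorder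
  proof (intro conjI allI impI QZ)
    fix X' assume "Q X'"
    have "norm (tau r (X', Y) $ i) \<ge> norm (ridge_update M P c A $ i)" for i
      using minimal[OF \<open>Q X'\<close>, of i] ridge_update_empty_row[of P i M c A] by (cases "P `` {i} = {}") auto
    then show "norm (tau r (Z, Y)) \<le> norm (tau r (X', Y))"
      unfolding tauZ norm_vec_def[of "_ :: _ ^ _ ^ _"] by (intro L2_set_mono) auto
  qed
  then have "is_arg_min (\<lambda>X'. norm (tau r (X', Y))) Q (arg_min (\<lambda>X'. norm (tau r (X', Y))) Q)"
    unfolding arg_min_def by (rule someI[of "is_arg_min (\<lambda>X'. norm (tau r (X', Y))) Q"])
  from sel[OF this] show ?thesis
    by (simp add: meth1_def XY Q_def w_def A_def c_def)
qed

section \<open>Transposition symmetry between the two methods\<close>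

lemma norm_transpose: "norm (transpose T) = norm T" for T :: "real ^ 'm::finite ^ 'n::finite"
  unfolding norm_eq_sqrt_inner inner_vec_def transpose_def by (simp, subst sum.swap) simp

text \<open>Exchanging the two factors preserves Lebesgue measure and transposes every product,
  which leaves Frobenius norms unchanged and turns the sample set into its converse.\<close>

lemma vres_swap:
  fixes X :: "nat \<Rightarrow> real ^ 'n::finite" and Y :: "nat \<Rightarrow> real ^ 'm::finite"
  assumes G: "(X, Y) \<in> reps r"
  shows "vres w M P r (X, Y) (X', Y') = vres w (transpose M) (P\<inverse>) r (Y, X) (Y', X')"
proof -
  let ?L = "lebesgue_reps r :: ('n, 'm) rep measure" and ?L' = "lebesgue_reps r :: ('m, 'n) rep measure"
  let ?f = "\<lambda>D :: ('m, 'n) rep. sqnorm_on (P\<inverse>) (tau r (\<lambda>k. Y' k + fst D k, \<lambda>k. X' k + snd D k) - transpose M)"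
  note swap [measurable] = distr_lebesgue_reps_swap(1)[of r, where 'm='m and 'n='n]
  have V [measurable]: "variation_set w r (Y, X) \<in> sets ?L'"
    using reps_swap[OF G] by (rule variation_set_measure)
  have [measurable]: "?f \<in> borel_measurable ?L'"
    by (intro borel_measurable_sqnorm_on borel_measurable_diff borel_measurable_tau) auto
  have f: "?f (prod.swap D) = sqnorm_on P (tau r (\<lambda>k. X' k + fst D k, \<lambda>k. Y' k + snd D k) - M)" for D
  proof -
    have "?f (prod.swap D) = (\<Sum>(j, i)\<in>P\<inverse>. ((tau r (\<lambda>k. X' k + fst D k, \<lambda>k. Y' k + snd D k) - M) $ i $ j)\<^sup>2)"
      unfolding sqnorm_on_def
      by (intro sum.cong) (auto simp: transpose_def tau_nth mult.commute)
    also have "\<dots> = sqnorm_on P (tau r (\<lambda>k. X' k + fst D k, \<lambda>k. Y' k + snd D k) - M)"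
      unfolding sqnorm_on_def by (rule sum.reindex_bij_witness[of _ prod.swap prod.swap]) auto
    finally show ?thesis .
  qed
  have mem: "prod.swap D \<in> variation_set w r (Y, X) \<longleftrightarrow> D \<in> variation_set w r (X, Y)" for D
    using norm_transpose[of "tau r (fst D, Y)"] norm_transpose[of "tau r (X, snd D)"]
    by (cases D) (auto simp: variation_set_def transpose_tau add.commute)
  have "vres w (transpose M) (P\<inverse>) r (Y, X) (Y', X') = (LINT D|?L'. indicator (variation_set w r (Y, X)) D * ?f D)"
    by (simp add: vres_def set_lebesgue_integral_def)
  also have "\<dots> = (LINT D|distr ?L ?L' prod.swap. indicator (variation_set w r (Y, X)) D * ?f D)"
    unfolding distr_lebesgue_reps_swap(2) ..
  also have "\<dots> = (LINT D|?L. indicator (variation_set w r (Y, X)) (prod.swap D) * ?f (prod.swap D))"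
    by (rule integral_distr) measurable
  also have "\<dots> = (LINT D|?L. indicator (variation_set w r (X, Y)) D
      * sqnorm_on P (tau r (\<lambda>k. X' k + fst D k, \<lambda>k. Y' k + snd D k) - M))"
    by (simp only: f mem indicator_def of_bool_def)
  also have "\<dots> = vres w M P r (X, Y) (X', Y')"
    by (simp add: vres_def set_lebesgue_integral_def)
  finally show ?thesis ..
qed

lemma tau_meth2:
  fixes M :: "real ^ 'm::finite ^ 'n::finite"
  assumes wt: "wt > 0" and G: "G \<in> reps r"
  shows "tau r (meth2 wt M P r G)
    = transpose (ridge_update (transpose M) (P\<inverse>) (wt\<^sup>2 / (real CARD('n) + real CARD('m))) (transpose (tau r G)))"
proof -
  obtain X Y where XY: "G = (X, Y)" by (cases G)
  have G': "(X, Y) \<in> reps r" using G XY by simp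
  have omega_sym: "omega TYPE('m) TYPE('n) wt r = omega TYPE('n) TYPE('m) wt r"
    by (simp add: omega_def add.commute)
  have norm_tau_sym: "norm (tau r (V, U)) = norm (tau r (U, V))" for U :: "nat \<Rightarrow> real ^ 'n" and V :: "nat \<Rightarrow> real ^ 'm"
    unfolding transpose_tau[of r U V, symmetric] by (rule norm_transpose)
  \<comment> \<open>The objectives of both minimisations agree as functions, so
    \<open>arg_min\<close> makes the same choice on both sides and the equality holds for the
    representations themselves.\<close>
  have "meth2 wt M P r (X, Y) = prod.swap (meth1 wt (transpose M) (P\<inverse>) r (Y, X))"
    by (simp add: meth1_def meth2_def vres_swap[OF G'] omega_sym norm_tau_sym)
  then have "tau r (meth2 wt M P r (X, Y)) = transpose (tau r (meth1 wt (transpose M) (P\<inverse>) r (Y, X)))"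
    by (cases "meth1 wt (transpose M) (P\<inverse>) r (Y, X)") (simp add: transpose_tau)
  also have "\<dots> = transpose (ridge_update (transpose M) (P\<inverse>) (wt\<^sup>2 / (real CARD('m) + real CARD('n))) (tau r (Y, X)))"
    using tau_meth1[OF wt reps_swap[OF G']] by simp
  finally show ?thesis by (simp add: XY transpose_tau add.commute)
qed

text \<open>A single continuous \<open>F\<close> for all ranks gives both halves of stability: the
  output depends on the product alone, and the induced function is \<open>F\<close>. The condition
  \<open>F 0 = 0\<close> matches the convention at the zero matrix.\<close>

lemma stable_methI:
  assumes eq: "\<And>r G. G \<in> reps r \<Longrightarrow> tau r (\<M> r G) = F (tau r G)"
    and F: "continuous_on UNIV F" "F 0 = 0"
  shows "stable_meth \<M>"
proof -
  have "induced_fun \<M> A = F A" for A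
  proof (cases "A = 0")
    case False
    let ?G = "SOME G. G \<in> reps (rank A) \<and> tau (rank A) G = A"
    have "?G \<in> reps (rank A) \<and> tau (rank A) ?G = A"
      using reps_exist[of A] by (rule someI_ex)
    then show ?thesis using False eq by (simp add: induced_fun_def)
  qed (simp add: induced_fun_def F)
  then have "induced_fun \<M> = F" by blast
  then show ?thesis
    using eq F by (simp add: stable_meth_def rep_independent_def)
qed

lemma continuous_transpose: "continuous_on UNIV (transpose :: real ^ 'm ^ 'n \<Rightarrow> _)"
  unfolding transpose_def[abs_def] by (intro continuous_intros continuous_on_vec_lambda)

theorem theorem3p7:
  fixes M :: "real ^ 'm ^ 'n"
    and P :: "('n::finite \<times> 'm::finite) set"
    and wt :: real
  assumes "wt > 0"
  shows "stable_meth (meth1 wt M P) \<and> stable_meth (meth2 wt M P)"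
proof
  define c where "c = wt\<^sup>2 / (real CARD('n) + real CARD('m))"
  have c: "c > 0" using assms by (simp add: c_def add_pos_pos)
  show "stable_meth (meth1 wt M P)"
    using tau_meth1[OF assms, of _ _ M P, folded c_def] continuous_ridge_update[OF c] ridge_update_zero
    by (rule stable_methI)
  show "stable_meth (meth2 wt M P)"
    using tau_meth2[OF assms, of _ _ M P, folded c_def]
  proof (rule stable_methI)
    show "continuous_on UNIV (\<lambda>A. transpose (ridge_update (transpose M) (P\<inverse>) c (transpose A)))"
      by (intro continuous_on_compose2[OF continuous_transpose] continuous_on_compose2[OF continuous_ridge_update[OF c]]
          continuous_transpose) auto
    show "transpose (ridge_update (transpose M) (P\<inverse>) c (transpose 0)) = 0"
      by (simp add: ridge_update_zero transpose_def zero_vec_def[symmetric] vec_eq_iff)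
  qed
qed

end
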